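(* Consider a reversible, irreducible, $\zeta$-lazy and smooth Markov chain on $\mathbb R^d$ with stationary distribution $\mu$. For any error tolerance $\varepsilon\in(0,1)$, the maximal mixing time in $\chi^2$ divergence of the chain over $M_0$-warm starts is bounded as $$\tau_{\rm mix}(\varepsilon,M_0)\le\frac{16}{\zeta}\int_{4/M_0}^{1/2}\frac{dv}{v\,\Phi_s^2(v)}+\frac{64}{\zeta}\int_{1/2}^{4\sqrt2/\varepsilon}\frac{dv}{v\,\Phi_s^2(\frac12)},\qquad s=\frac{\varepsilon^2}{16M_0^2}.$$
   Context: Let $T(x,dy)$ be the transition kernel. Reversible: $\mu(dx)T(x,dy)=\mu(dy)T(y,dx)$. Irreducible: for all $x,y$ there is a natural number $k>0$ with $T^k(x,dy)>0$, $T^k$ being the $k$-step kernel. $\zeta$-lazy: at each iteration the chain is forced to stay at the previous iterate with probability $\zeta$. Smooth: $T(x,dy)=\theta(x,y)\,dy+\alpha_x\delta_x(dy)$ for a transition density function $\theta$, with $\delta_x$ the Dirac measure at $x$. Ergodic flow: $\phi(S)=\int_ST(x,S^c)\,\mu(dx)$. The $s$-conductance profile is, for $s\in(0,\frac12)$ and $v\in(s,\frac12]$, $$\Phi_s(v)=\inf\Big\{\frac{\phi(S)}{\mu(S)-s}:\ s<\mu(S)\le v\Big\}.$$ $\mu_0$ is an $M_0$-warm start if $\mu_0(E)\le M_0\mu(E)$ for all Borel $E\subset\mathbb R^d$. With $\mu_k$ the law after $k$ steps from $\mu_0$, $\tau_{\rm mix}(\varepsilon,\mu_0)=\inf\{k\in\mathbb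 N:\sqrt{\chi^2(\mu_k,\mu)}\le\varepsilon\}$, and $\tau_{\rm mix}(\varepsilon,M_0)$ is the maximum over $M_0$-warm starts $\mu_0$. *)

theory Defs
  imports "HOL-Probability.Probability"
begin

section \<open>Markov kernels on a Euclidean space\<close>

definition markov_kernel :: "('a::euclidean_space \<Rightarrow> 'a measure) \<Rightarrow> bool" where
  "markov_kernel T \<longleftrightarrow> T \<in> borel \<rightarrow>\<^sub>M prob_algebra borel"

definition law_after :: "('a::euclidean_space \<Rightarrow> 'a measure) \<Rightarrow> nat \<Rightarrow> 'a measure \<Rightarrow> 'a measure" where
  "law_after T k \<nu> = ((\<lambda>\<rho>. \<rho> \<bind> T) ^^ k) \<nu>"

definition step_kernel :: "('a::euclidean_space \<Rightarrow> 'a measure) \<Rightarrow> nat \<Rightarrow> 'a \<Rightarrow> 'a measure" where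
  "step_kernel T k x = law_after T k (return borel x)"

definition stationary :: "'a::euclidean_space measure \<Rightarrow> ('a \<Rightarrow> 'a measure) \<Rightarrow> bool" where
  "stationary \<mu> T \<longleftrightarrow> \<mu> \<in> space (prob_algebra borel) \<and> \<mu> \<bind> T = \<mu>"

text \<open>Equality of the measures \<open>\<mu>(dx) T(x,dy)\<close> and \<open>\<mu>(dy) T(y,dx)\<close> on the product space.\<close>

definition reversible :: "'a::euclidean_space measure \<Rightarrow> ('a \<Rightarrow> 'a measure) \<Rightarrow> bool" where
  "reversible \<mu> T \<longleftrightarrow>
     \<mu> \<bind> (\<lambda>x. T x \<bind> (\<lambda>y. return (borel \<Otimes>\<^sub>M borel) (x, y))) =
     \<mu> \<bind> (\<lambda>y. T y \<bind> (\<lambda>x. return (borel \<Otimes>\<^sub>M borel) (x, y)))"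

text \<open>The condition \<open>T\<^sup>k(x,dy) > 0\<close> at a point \<open>y\<close> means that \<open>T\<^sup>k(x,\<cdot>)\<close> charges every
  neighbourhood of \<open>y\<close>; the same \<open>k\<close> serves all neighbourhoods.\<close>

definition irreducible_chain :: "('a::euclidean_space \<Rightarrow> 'a measure) \<Rightarrow> bool" where
  "irreducible_chain T \<longleftrightarrow>
     (\<forall>x y. \<exists>k>0. \<forall>U. open U \<and> y \<in> U \<longrightarrow> emeasure (step_kernel T k x) U > 0)"

definition lazy_chain :: "real \<Rightarrow> ('a::euclidean_space \<Rightarrow> 'a measure) \<Rightarrow> bool" where
  "lazy_chain \<zeta> T \<longleftrightarrow> 0 \<le> \<zeta> \<and> \<zeta> \<le> 1 \<and>
     (\<exists>K. markov_kernel K \<and>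
        (\<forall>x. \<forall>A\<in>sets borel.
           emeasure (T x) A =
             ennreal \<zeta> * emeasure (return borel x) A + ennreal (1 - \<zeta>) * emeasure (K x) A))"

definition smooth_chain :: "('a::euclidean_space \<Rightarrow> 'a measure) \<Rightarrow> bool" where
  "smooth_chain T \<longleftrightarrow>
     (\<exists>(\<theta> :: 'a \<Rightarrow> 'a \<Rightarrow> ennreal) (\<alpha> :: 'a \<Rightarrow> ennreal).
        case_prod \<theta> \<in> borel_measurable (borel \<Otimes>\<^sub>M borel) \<and>
        (\<forall>x. \<forall>A\<in>sets borel.
           emeasure (T x) A = (\<integral>\<^sup>+y\<in>A. \<theta> x y \<partial>lborel) + \<alpha> x * emeasure (return borel x) A))"


section \<open>Conductance profile\<close>

definition ergodic_flow :: "'a::euclidean_space measure \<Rightarrow> ('a \<Rightarrow> 'a measure) \<Rightarrow> 'a set \<Rightarrow> ennreal" where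
  "ergodic_flow \<mu> T S = (\<integral>\<^sup>+x\<in>S. emeasure (T x) (- S) \<partial>\<mu>)"

definition conductance_profile ::
  "'a::euclidean_space measure \<Rightarrow> ('a \<Rightarrow> 'a measure) \<Rightarrow> real \<Rightarrow> real \<Rightarrow> ennreal" where
  "conductance_profile \<mu> T s v =
     (INF S\<in>{S \<in> sets borel. s < measure \<mu> S \<and> measure \<mu> S \<le> v}.
        ergodic_flow \<mu> T S / ennreal (measure \<mu> S - s))"


section \<open>Mixing time in chi-squared divergence\<close>

definition chi2_divergence :: "'a measure \<Rightarrow> 'a measure \<Rightarrow> ennreal" where
  "chi2_divergence \<nu> \<mu> =
     (if absolutely_continuous \<mu> \<nu>
      then \<integral>\<^sup>+x. ennreal ((enn2real (RN_deriv \<mu> \<nu> x) - 1)\<^sup>2) \<partial>\<mu>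
      else \<infinity>)"

definition warm_starts :: "real \<Rightarrow> 'a::euclidean_space measure \<Rightarrow> 'a measure set" where
  "warm_starts M \<mu> =
     {\<nu> \<in> space (prob_algebra borel). \<forall>E\<in>sets borel. measure \<nu> E \<le> M * measure \<mu> E}"

text \<open>Both times are extended naturals. The finiteness conjunct below is needed because
  \<^const>\<open>enn2real\<close> sends infinity to 0.\<close>

definition mixing_time ::
  "'a::euclidean_space measure \<Rightarrow> ('a \<Rightarrow> 'a measure) \<Rightarrow> real \<Rightarrow> 'a measure \<Rightarrow> enat" where
  "mixing_time \<mu> T \<epsilon> \<nu> =
     Inf (enat ` {k. chi2_divergence (law_after T k \<nu>) \<mu> < \<infinity> \<and>
                     sqrt (enn2real (chi2_divergence (law_after T k \<nu>) \<mu>)) \<le> \<epsilon>})"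

definition max_mixing_time ::
  "'a::euclidean_space measure \<Rightarrow> ('a \<Rightarrow> 'a measure) \<Rightarrow> real \<Rightarrow> real \<Rightarrow> enat" where
  "max_mixing_time \<mu> T \<epsilon> M = (SUP \<nu>\<in>warm_starts M \<mu>. mixing_time \<mu> T \<epsilon> \<nu>)"

end

theory Submission
  imports Defs
begin

text \<open>
  Let \<open>h\<^sub>k\<close> be the density of the \<open>k\<close>-th law and \<open>V\<^sub>k\<close> its variance, which is the
  \<open>\<chi>\<^sup>2\<close>-divergence. By reversibility \<open>h\<^sub>k\<^sub>+\<^sub>1 = T h\<^sub>k\<close>, so \<open>0 \<le> h\<^sub>k \<le> M\<^sub>0\<close> for all \<open>k\<close>, and laziness gives
  \<open>V\<^sub>k - V\<^sub>k\<^sub>+\<^sub>1 \<ge> 2 \<zeta> E(h\<^sub>k)\<close> with \<open>E\<close> the Dirichlet form. A Cheeger inequality for bounded functions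
  (the \<open>s\<close> in the profile costs a term \<open>2 s M\<^sub>0\<^sup>2 = \<epsilon>\<^sup>2 / 8\<close>) gives
  \<open>E(h\<^sub>k) \<ge> \<Phi>\<^sub>s(min (1/2) (4/V\<^sub>k))\<^sup>2 V\<^sub>k / 4\<close> as long as \<open>V\<^sub>k > \<epsilon>\<^sup>2\<close>: for \<open>V\<^sub>k \<ge> 8\<close> apply it to \<open>(h\<^sub>k - V\<^sub>k/4)\<^sub>+\<close>,
  whose support has measure at most \<open>4/V\<^sub>k\<close> by Markov's inequality, and otherwise to the positive
  and negative parts of \<open>h\<^sub>k\<close> minus its median. In the variable \<open>v = 4/V\<close> each step then uses up at
  least \<open>\<zeta>/4\<close> of the integral of \<open>1/(v \<Phi>\<^sub>s(min (1/2) v)\<^sup>2)\<close>, which bounds the number of steps.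
\<close>

section \<open>Integrals and medians\<close>

lemma abs_power2_le: "\<bar>a\<bar> \<le> B \<Longrightarrow> \<bar>a\<^sup>2\<bar> \<le> B\<^sup>2" for a B :: real
  using power_mono[of "\<bar>a\<bar>" B 2] by simp

text \<open>The median is the infimum \<open>m\<close> of the levels whose upper tail has
  probability at most 1/2. Levels on either side of \<open>m\<close> satisfy the matching bound, and
  continuity from below carries both bounds to \<open>m\<close>.\<close>

lemma (in prob_space) median_exists:
  fixes h :: "'a \<Rightarrow> real"
  assumes [measurable]: "h \<in> borel_measurable M" and h: "\<And>x. x \<in> space M \<Longrightarrow> 0 \<le> h x" "\<And>x. x \<in> space M \<Longrightarrow> h x \<le> B"
  obtains m where "0 \<le> m" "m \<le> B" "prob {x \<in> space M. m < h x} \<le> 1 / 2" "prob {x \<in> space M. h x < m} \<le> 1 / 2"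
proof -
  obtain x0 where "x0 \<in> space M" using not_empty by blast
  then have B: "0 \<le> B" using h[of x0] by linarith
  define A where "A = {t. 0 \<le> t \<and> prob {x \<in> space M. t < h x} \<le> 1 / 2}"
  define m where "m = Inf A"
  have "{x \<in> space M. B < h x} = {}" using h(2) by fastforce
  then have "prob {x \<in> space M. B < h x} = 0" by (simp only: measure_empty)
  then have BA: "B \<in> A" using B by (simp add: A_def)
  have bdd: "bdd_below A" by (auto simp: A_def intro!: bdd_belowI[of _ 0])
  have m0: "0 \<le> m" unfolding m_def using BA by (intro cInf_greatest) (auto simp: A_def)
  have mB: "m \<le> B" unfolding m_def using BA bdd by (rule cInf_lower)
  have up: "prob {x \<in> space M. t < h x} \<le> 1 / 2" if mt: "m < t" for t
  proof -
    obtain a where a: "a \<in> A" "a < t" using cInf_lessD[of A t] mt BA by (auto simp: m_def)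
    have "prob {x \<in> space M. t < h x} \<le> prob {x \<in> space M. a < h x}"
      using a by (intro finite_measure_mono) auto
    then show ?thesis using a by (simp add: A_def)
  qed
  have "(\<lambda>n. prob {x \<in> space M. m + inverse (Suc n) < h x}) \<longlonglongrightarrow> prob (\<Union>n. {x \<in> space M. m + inverse (Suc n) < h x})"
  proof (intro finite_Lim_measure_incseq incseq_SucI subsetI)
    fix n x assume "x \<in> {x \<in> space M. m + inverse (Suc n) < h x}"
    moreover have "inverse (real (Suc (Suc n))) \<le> inverse (real (Suc n))" by (intro le_imp_inverse_le) auto
    ultimately show "x \<in> {x \<in> space M. m + inverse (Suc (Suc n)) < h x}" unfolding mem_Collect_eq by linarith
  qed auto
  moreover have "(\<Union>n. {x \<in> space M. m + inverse (Suc n) < h x}) = {x \<in> space M. m < h x}"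
  proof (intro equalityI subsetI)
    fix x assume x: "x \<in> {x \<in> space M. m < h x}"
    then obtain n where "inverse (real (Suc n)) < h x - m" using reals_Archimedean[of "h x - m"] by auto
    then show "x \<in> (\<Union>n. {x \<in> space M. m + inverse (Suc n) < h x})" using x by (auto intro!: exI[of _ n])
  next
    fix x assume "x \<in> (\<Union>n. {x \<in> space M. m + inverse (Suc n) < h x})"
    then obtain n where "x \<in> space M" "m + inverse (real (Suc n)) < h x" by auto
    moreover have "0 < inverse (real (Suc n))" by simp
    ultimately show "x \<in> {x \<in> space M. m < h x}" unfolding mem_Collect_eq by linarith
  qed
  ultimately have "(\<lambda>n. prob {x \<in> space M. m + inverse (Suc n) < h x}) \<longlonglongrightarrow> prob {x \<in> space M. m < h x}"
    by simp
  then have above: "prob {x \<in> space M. m < h x} \<le> 1 / 2"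
    by (rule Lim_bounded[where M = 0]) (intro allI impI up, simp)
  have low: "prob {x \<in> space M. h x < t} \<le> 1 / 2" if "t < m" for t
  proof (cases "0 \<le> t")
    case True
    \<comment> \<open>A nonnegative level below the infimum has upper tail above 1/2, which leaves
      less than 1/2 for the disjoint lower tail.\<close>
    have "t \<notin> A" using that bdd cInf_lower unfolding m_def by fastforce
    then have "1 / 2 < prob {x \<in> space M. t < h x}" using True by (simp add: A_def)
    moreover have "prob {x \<in> space M. t < h x} + prob {x \<in> space M. h x < t} = prob ({x \<in> space M. t < h x} \<union> {x \<in> space M. h x < t})"
      by (rule finite_measure_Union[symmetric]) auto
    moreover have "\<dots> \<le> 1" by (rule prob_le_1)
    ultimately show ?thesis by linarith
  next
    case False
    then have "{x \<in> space M. h x < t} = {}" using h(1) by fastforce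
    then show ?thesis by (simp only: measure_empty)
  qed
  have "(\<lambda>n. prob {x \<in> space M. h x < m - inverse (Suc n)}) \<longlonglongrightarrow> prob (\<Union>n. {x \<in> space M. h x < m - inverse (Suc n)})"
  proof (intro finite_Lim_measure_incseq incseq_SucI subsetI)
    fix n x assume "x \<in> {x \<in> space M. h x < m - inverse (Suc n)}"
    moreover have "inverse (real (Suc (Suc n))) \<le> inverse (real (Suc n))" by (intro le_imp_inverse_le) auto
    ultimately show "x \<in> {x \<in> space M. h x < m - inverse (Suc (Suc n))}" unfolding mem_Collect_eq by linarith
  qed auto
  moreover have "(\<Union>n. {x \<in> space M. h x < m - inverse (Suc n)}) = {x \<in> space M. h x < m}"
  proof (intro equalityI subsetI)
    fix x assume x: "x \<in> {x \<in> space M. h x < m}"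
    then obtain n where "inverse (real (Suc n)) < m - h x" using reals_Archimedean[of "m - h x"] by auto
    then show "x \<in> (\<Union>n. {x \<in> space M. h x < m - inverse (Suc n)})" using x by (auto intro!: exI[of _ n])
  next
    fix x assume "x \<in> (\<Union>n. {x \<in> space M. h x < m - inverse (Suc n)})"
    then obtain n where "x \<in> space M" "h x < m - inverse (real (Suc n))" by auto
    moreover have "0 < inverse (real (Suc n))" by simp
    ultimately show "x \<in> {x \<in> space M. h x < m}" unfolding mem_Collect_eq by linarith
  qed
  ultimately have "(\<lambda>n. prob {x \<in> space M. h x < m - inverse (Suc n)}) \<longlonglongrightarrow> prob {x \<in> space M. h x < m}"
    by simp
  then have below: "prob {x \<in> space M. h x < m} \<le> 1 / 2"
    by (rule Lim_bounded[where M = 0]) (intro allI impI low, simp)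
  show thesis using that[OF m0 mB above below] .
qed

section \<open>Reciprocals in the extended reals and measurability of antitone functions\<close>

lemma inverse_ennreal_antimono: "y \<le> x \<Longrightarrow> inverse x \<le> inverse (y :: ennreal)"
  including ennreal.lifting by transfer (simp add: ereal_inverse_antimono)

text \<open>A positive real factor rules out the product of 0 and top, so the formula survives when
  \<open>x\<close>, later a squared profile value, is 0 or infinite.\<close>

lemma inverse_ennreal_mult_real:
  fixes x :: ennreal
  assumes "0 < a"
  shows "1 / (ennreal a * x) = ennreal (1 / a) * inverse x"
  using assms by (simp add: divide_ennreal_def ennreal_inverse_mult' inverse_ennreal inverse_eq_divide)

text \<open>A down-set is empty, the whole line, or a ray ending at its supremum with or without the
  endpoint. Superlevel sets of antitone functions are down-sets, which makes the profile integrands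
  measurable.\<close>

lemma downward_closed_borel:
  fixes A :: "real set"
  assumes down: "\<And>x y. y \<in> A \<Longrightarrow> x \<le> y \<Longrightarrow> x \<in> A"
  shows "A \<in> sets borel"
proof (cases "bdd_above A \<and> A \<noteq> {}")
  case True
  have "A = {..<Sup A} \<union> (A \<inter> {Sup A})"
  proof (intro equalityI subsetI)
    fix x assume "x \<in> A"
    then show "x \<in> {..<Sup A} \<union> (A \<inter> {Sup A})" using cSup_upper[of x A] True by force
  next
    fix x assume x: "x \<in> {..<Sup A} \<union> (A \<inter> {Sup A})"
    show "x \<in> A"
    proof (cases "x < Sup A")
      case xs: True
      then obtain y where "y \<in> A" "x < y" using less_cSupD[of A x] True by blast
      then show ?thesis using down by force
    qed (use x in auto)
  qed
  moreover have "A \<inter> {Sup A} = {} \<or> A \<inter> {Sup A} = {Sup A}" by auto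
  then have "A \<inter> {Sup A} \<in> sets borel" by (metis borel_singleton sets.empty_sets)
  then have "{..<Sup A} \<union> (A \<inter> {Sup A}) \<in> sets borel" by (intro sets.Un) simp_all
  ultimately show ?thesis by simp
next
  case False
  have "A = UNIV" if unbounded: "\<not> bdd_above A"
  proof (intro equalityI subsetI)
    fix x :: real
    obtain y where "y \<in> A" "x \<le> y" using unbounded by (auto simp: bdd_above_def not_le intro: less_imp_le)
    then show "x \<in> A" using down by blast
  qed simp
  then show ?thesis using False by auto
qed

lemma borel_measurable_antimono_ennreal:
  fixes f :: "real \<Rightarrow> ennreal"
  assumes "antimono f"
  shows "f \<in> borel_measurable borel"
proof (rule borel_measurableI_greater)
  fix y
  have "{x. y < f x} \<in> sets borel"
    by (rule downward_closed_borel) (use assms in \<open>auto dest: antimonoD intro: order.strict_trans2\<close>)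
  then show "{x \<in> space borel. y < f x} \<in> sets borel" by simp
qed

lemma nn_integral_inverse_Icc:
  fixes a b :: real
  assumes "0 < a" "a \<le> b"
  shows "(\<integral>\<^sup>+v\<in>{a..b}. ennreal (1 / v) \<partial>lborel) = ennreal (ln (b / a))"
proof -
  have "(\<integral>\<^sup>+v. ennreal (1 / v) * indicator {a..b} v \<partial>lborel) = ennreal (ln b - ln a)"
    using assms by (intro nn_integral_FTC_Icc) (auto intro!: derivative_eq_intros)
  then show ?thesis using assms by (simp add: ln_div)
qed

text \<open>A larger volume bound admits more sets to the infimum.\<close>

lemma conductance_profile_antimono: "antimono (conductance_profile \<mu> T s)"
  unfolding conductance_profile_def by (intro antimonoI INF_superset_mono) auto

section \<open>Reversible kernels\<close>

locale reversible_chain =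
  fixes \<mu> :: "'a::euclidean_space measure" and T :: "'a \<Rightarrow> 'a measure"
  assumes kernel: "markov_kernel T"
    and stat: "stationary \<mu> T"
    and rev: "reversible \<mu> T"
begin

lemma T_meas[measurable]: "T \<in> borel \<rightarrow>\<^sub>M prob_algebra borel"
  using kernel by (simp add: markov_kernel_def)

lemma sets_mu[measurable_cong, simp]: "sets \<mu> = sets borel"
  using stat by (simp add: stationary_def space_prob_algebra)

lemma space_mu[simp]: "space \<mu> = UNIV"
  using sets_eq_imp_space_eq[OF sets_mu] by simp

lemma sets_T[measurable_cong, simp]: "sets (T x) = sets borel"
  using measurable_space[OF T_meas, of x] by (simp add: space_prob_algebra)

lemma space_T[simp]: "space (T x) = UNIV"
  using sets_eq_imp_space_eq[OF sets_T] by simp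

lemma prob_T: "prob_space (T x)"
  using measurable_space[OF T_meas, of x] by (simp add: space_prob_algebra)

sublocale mu: prob_space \<mu>
  using stat by (simp add: stationary_def space_prob_algebra)

sublocale T: prob_space "T x" for x
  by (rule prob_T)

text \<open>The joint law of two consecutive states of the stationary chain. Reversibility is its
  invariance under exchanging the coordinates.\<close>

definition flow_measure :: "('a \<times> 'a) measure" where
  "flow_measure = \<mu> \<bind> (\<lambda>x. T x \<bind> (\<lambda>y. return (borel \<Otimes>\<^sub>M borel) (x, y)))"

lemma kernel_pair_meas:
  "(\<lambda>x. T x \<bind> (\<lambda>y. return (borel \<Otimes>\<^sub>M borel) (x, y))) \<in> borel \<rightarrow>\<^sub>M prob_algebra (borel \<Otimes>\<^sub>M borel)"
  by measurable

lemma kernel_pair_meas':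
  "(\<lambda>x. T x \<bind> (\<lambda>y. return (borel \<Otimes>\<^sub>M borel) (y, x))) \<in> borel \<rightarrow>\<^sub>M prob_algebra (borel \<Otimes>\<^sub>M borel)"
  by measurable

lemma mu_in: "\<mu> \<in> space (prob_algebra borel)"
  by (simp add: space_prob_algebra mu.prob_space_axioms)

lemma prob_flow: "prob_space flow_measure"
  unfolding flow_measure_def by (rule prob_space_bind'[OF mu_in kernel_pair_meas])

sublocale J: prob_space flow_measure
  by (rule prob_flow)

lemma sets_flow[measurable_cong, simp]: "sets flow_measure = sets (borel \<Otimes>\<^sub>M borel)"
  unfolding flow_measure_def by (rule sets_bind'[OF mu_in kernel_pair_meas])

lemma space_flow[simp]: "space flow_measure = UNIV"
  using sets_eq_imp_space_eq[OF sets_flow] by (simp add: space_pair_measure)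

lemma nn_integral_flow:
  assumes [measurable]: "f \<in> borel_measurable (borel \<Otimes>\<^sub>M borel)"
  shows "(\<integral>\<^sup>+z. f z \<partial>flow_measure) = (\<integral>\<^sup>+x. \<integral>\<^sup>+y. f (x, y) \<partial>T x \<partial>\<mu>)"
proof -
  have "(\<integral>\<^sup>+z. f z \<partial>flow_measure) = (\<integral>\<^sup>+x. \<integral>\<^sup>+z. f z \<partial>(T x \<bind> (\<lambda>y. return (borel \<Otimes>\<^sub>M borel) (x, y))) \<partial>\<mu>)"
    unfolding flow_measure_def
    using measurable_prob_algebraD[OF kernel_pair_meas] by (intro nn_integral_bind[where B = "borel \<Otimes>\<^sub>M borel"]) simp_all
  also have "\<dots> = (\<integral>\<^sup>+x. \<integral>\<^sup>+y. f (x, y) \<partial>T x \<partial>\<mu>)"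
  proof (intro nn_integral_cong)
    fix x
    have "(\<lambda>y. return (borel \<Otimes>\<^sub>M borel) (x, y)) \<in> T x \<rightarrow>\<^sub>M subprob_algebra (borel \<Otimes>\<^sub>M borel)"
      by (intro measurable_prob_algebraD) measurable
    then show "(\<integral>\<^sup>+z. f z \<partial>(T x \<bind> (\<lambda>y. return (borel \<Otimes>\<^sub>M borel) (x, y)))) = (\<integral>\<^sup>+y. f (x, y) \<partial>T x)"
      by (subst nn_integral_bind[where B = "borel \<Otimes>\<^sub>M borel"]) (auto simp: nn_integral_return space_pair_measure)
  qed
  finally show ?thesis .
qed

text \<open>Reversibility rewrites the flow measure as the version that draws the second coordinate
  from \<open>\<mu>\<close> and the first from the kernel, so integration against it exchanges the
  arguments of \<open>f\<close>.\<close>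

lemma nn_integral_flow_swap:
  assumes [measurable]: "f \<in> borel_measurable (borel \<Otimes>\<^sub>M borel)"
  shows "(\<integral>\<^sup>+z. f (snd z, fst z) \<partial>flow_measure) = (\<integral>\<^sup>+z. f z \<partial>flow_measure)"
proof -
  have "(\<integral>\<^sup>+z. f z \<partial>flow_measure) =
    (\<integral>\<^sup>+x. \<integral>\<^sup>+z. f z \<partial>(T x \<bind> (\<lambda>y. return (borel \<Otimes>\<^sub>M borel) (y, x))) \<partial>\<mu>)"
    unfolding flow_measure_def rev[unfolded reversible_def]
    using measurable_prob_algebraD[OF kernel_pair_meas'] by (intro nn_integral_bind[where B = "borel \<Otimes>\<^sub>M borel"]) simp_all
  also have "\<dots> = (\<integral>\<^sup>+x. \<integral>\<^sup>+y. f (y, x) \<partial>T x \<partial>\<mu>)"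
  proof (intro nn_integral_cong)
    fix x
    have "(\<lambda>y. return (borel \<Otimes>\<^sub>M borel) (y, x)) \<in> T x \<rightarrow>\<^sub>M subprob_algebra (borel \<Otimes>\<^sub>M borel)"
      by (intro measurable_prob_algebraD) measurable
    then show "(\<integral>\<^sup>+z. f z \<partial>(T x \<bind> (\<lambda>y. return (borel \<Otimes>\<^sub>M borel) (y, x)))) = (\<integral>\<^sup>+y. f (y, x) \<partial>T x)"
      by (subst nn_integral_bind[where B = "borel \<Otimes>\<^sub>M borel"]) (auto simp: nn_integral_return space_pair_measure)
  qed
  finally show ?thesis by (simp add: nn_integral_flow)
qed

lemma distr_flow_swap: "distr flow_measure (borel \<Otimes>\<^sub>M borel) (\<lambda>z. (snd z, fst z)) = flow_measure"
proof (rule measure_eqI)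
  fix A assume "A \<in> sets (distr flow_measure (borel \<Otimes>\<^sub>M borel) (\<lambda>z. (snd z, fst z)))"
  then have [measurable]: "A \<in> sets (borel \<Otimes>\<^sub>M borel)" by simp
  have "emeasure (distr flow_measure (borel \<Otimes>\<^sub>M borel) (\<lambda>z. (snd z, fst z))) A
    = (\<integral>\<^sup>+z. indicator A (snd z, fst z) \<partial>flow_measure)"
    by (subst nn_integral_indicator[symmetric], simp, subst nn_integral_distr) measurable
  also have "\<dots> = emeasure flow_measure A"
    by (subst nn_integral_flow_swap) auto
  finally show "emeasure (distr flow_measure (borel \<Otimes>\<^sub>M borel) (\<lambda>z. (snd z, fst z))) A = emeasure flow_measure A" .
qed simp

lemma distr_flow_fst: "distr flow_measure borel fst = \<mu>"
proof (rule measure_eqI)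
  fix A assume "A \<in> sets (distr flow_measure borel fst)"
  then have [measurable]: "A \<in> sets borel" by simp
  have "emeasure (distr flow_measure borel fst) A = (\<integral>\<^sup>+z. indicator A (fst z) \<partial>flow_measure)"
    by (subst nn_integral_indicator[symmetric], simp, subst nn_integral_distr) measurable
  also have "\<dots> = emeasure \<mu> A"
    by (subst nn_integral_flow) (auto simp: T.emeasure_space_1[simplified])
  finally show "emeasure (distr flow_measure borel fst) A = emeasure \<mu> A" .
qed simp

lemma distr_flow_snd: "distr flow_measure borel snd = \<mu>"
proof -
  have "distr flow_measure borel snd = distr (distr flow_measure (borel \<Otimes>\<^sub>M borel) (\<lambda>z. (snd z, fst z))) borel fst"
    by (subst distr_distr) (auto simp: comp_def)
  then show ?thesis by (simp add: distr_flow_swap distr_flow_fst)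
qed

lemma integral_flow_fst:
  fixes f :: "'a \<Rightarrow> real"
  assumes [measurable]: "f \<in> borel_measurable borel"
  shows "(\<integral>z. f (fst z) \<partial>flow_measure) = (\<integral>x. f x \<partial>\<mu>)"
  by (subst (2) distr_flow_fst[symmetric], subst integral_distr) auto

lemma integral_flow_snd:
  fixes f :: "'a \<Rightarrow> real"
  assumes [measurable]: "f \<in> borel_measurable borel"
  shows "(\<integral>z. f (snd z) \<partial>flow_measure) = (\<integral>x. f x \<partial>\<mu>)"
  by (subst (2) distr_flow_snd[symmetric], subst integral_distr) auto

lemma integral_flow_swap:
  fixes f :: "'a \<times> 'a \<Rightarrow> real"
  assumes [measurable]: "f \<in> borel_measurable (borel \<Otimes>\<^sub>M borel)"
  shows "(\<integral>z. f (snd z, fst z) \<partial>flow_measure) = (\<integral>z. f z \<partial>flow_measure)"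
  by (subst (2) distr_flow_swap[symmetric], subst integral_distr) auto

section \<open>Ergodic flow, coarea formula and Cheeger inequality\<close>

lemma flow_ergodic:
  assumes [measurable]: "S \<in> sets borel"
  shows "ergodic_flow \<mu> T S = (\<integral>\<^sup>+z. indicator S (fst z) * indicator (- S) (snd z) \<partial>flow_measure)"
proof -
  have "(\<integral>\<^sup>+z. indicator S (fst z) * indicator (- S) (snd z) \<partial>flow_measure)
    = (\<integral>\<^sup>+x. \<integral>\<^sup>+y. indicator S x * indicator (- S) y \<partial>T x \<partial>\<mu>)"
    by (subst nn_integral_flow) auto
  also have "\<dots> = (\<integral>\<^sup>+x. emeasure (T x) (- S) * indicator S x \<partial>\<mu>)"
    by (intro nn_integral_cong) (simp add: nn_integral_cmult mult.commute)
  finally show ?thesis by (simp add: ergodic_flow_def)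
qed

lemma bounded_integrable_mu:
  fixes f :: "'a \<Rightarrow> real"
  assumes "f \<in> borel_measurable borel" "\<And>x. \<bar>f x\<bar> \<le> B"
  shows "integrable \<mu> f"
  by (rule mu.integrable_const_bound[where B = B]) (use assms in auto)

lemma bounded_integrable_T:
  fixes f :: "'a \<Rightarrow> real"
  assumes "f \<in> borel_measurable borel" "\<And>x. \<bar>f x\<bar> \<le> B"
  shows "integrable (T x) f"
  by (rule T.integrable_const_bound[where B = B]) (use assms in auto)

lemma bounded_integrable_flow:
  fixes f :: "'a \<times> 'a \<Rightarrow> real"
  assumes "f \<in> borel_measurable (borel \<Otimes>\<^sub>M borel)" "\<And>x. \<bar>f x\<bar> \<le> B"
  shows "integrable flow_measure f"
  by (rule J.integrable_const_bound[where B = B]) (use assms in auto)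

text \<open>Clearing the denominator \<open>measure \<mu> S - s\<close> puts \<open>p * s\<close> on
  the right. With this term the bound also covers sets of measure at most \<open>s\<close>, so it
  applies to every superlevel set of a function whose support obeys the volume bound.\<close>

lemma conductance_ineq:
  assumes S[measurable]: "S \<in> sets borel" and "measure \<mu> S \<le> v" "0 \<le> p" "0 \<le> s"
    and p: "ennreal p \<le> conductance_profile \<mu> T s v"
  shows "ennreal p * emeasure \<mu> S \<le> ergodic_flow \<mu> T S + ennreal (p * s)"
proof (cases "s < measure \<mu> S")
  case True
  define r where "r = measure \<mu> S - s"
  have r: "0 < r" using True by (simp add: r_def)
  have "ennreal p \<le> ergodic_flow \<mu> T S / ennreal r"
    using p assms(2) True unfolding conductance_profile_def r_def le_INF_iff by auto
  then have "ennreal p * ennreal r \<le> ergodic_flow \<mu> T S / ennreal r * ennreal r"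
    by (intro mult_right_mono) auto
  also have "\<dots> = ergodic_flow \<mu> T S"
    using r by (simp add: ennreal_divide_times ennreal_times_divide mult_divide_eq_ennreal)
  finally have "ennreal p * ennreal r + ennreal (p * s) \<le> ergodic_flow \<mu> T S + ennreal (p * s)"
    by (intro add_right_mono)
  moreover have "ennreal p * ennreal r + ennreal (p * s) = ennreal p * emeasure \<mu> S"
    using assms r by (simp add: mu.emeasure_eq_measure ennreal_mult[symmetric] ennreal_plus[symmetric] del: ennreal_plus)
      (simp add: r_def algebra_simps)
  ultimately show ?thesis by simp
next
  case False
  have "ennreal p * emeasure \<mu> S \<le> ennreal (p * s)"
    using False assms by (simp add: mu.emeasure_eq_measure ennreal_mult[symmetric] ennreal_leI mult_left_mono)
  also have "\<dots> \<le> ergodic_flow \<mu> T S + ennreal (p * s)" by simp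
  finally show ?thesis .
qed

text \<open>Coarea formula. As \<^const>\<open>ennreal\<close> sends negative numbers to 0, the integral over the flow
  measure is that of the positive part of \<open>g x - g y\<close>.\<close>

lemma coarea_conductance:
  fixes g :: "'a \<Rightarrow> real"
  assumes [measurable]: "g \<in> borel_measurable borel" and g: "\<And>x. 0 \<le> g x" "\<And>x. g x \<le> B"
    and v: "measure \<mu> {x. 0 < g x} \<le> v" and "0 \<le> p" "0 \<le> s"
    and p: "ennreal p \<le> conductance_profile \<mu> T s v"
  shows "ennreal p * (\<integral>\<^sup>+x. ennreal (g x) \<partial>\<mu>)
    \<le> (\<integral>\<^sup>+z. ennreal (g (fst z) - g (snd z)) \<partial>flow_measure) + ennreal (p * s * B)"
proof -
  interpret L: pair_sigma_finite \<mu> "lborel :: real measure" ..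
  interpret M: pair_sigma_finite flow_measure "lborel :: real measure" ..
  have B: "0 \<le> B" using g[of undefined] by linarith
  \<comment> \<open>Layer cake: \<open>g x\<close> is the length of the interval of levels from 0 to
    \<open>g x\<close>.\<close>
  have "(\<integral>\<^sup>+x. ennreal (g x) \<partial>\<mu>) = (\<integral>\<^sup>+x. \<integral>\<^sup>+t. (if 0 \<le> t \<and> t < g x then 1 else 0) \<partial>lborel \<partial>\<mu>)"
  proof (intro nn_integral_cong)
    fix x
    have "(\<integral>\<^sup>+t. (if 0 \<le> t \<and> t < g x then 1 else 0) \<partial>lborel) = (\<integral>\<^sup>+t. indicator {0..<g x} t \<partial>lborel)"
      by (intro nn_integral_cong) auto
    then show "ennreal (g x) = (\<integral>\<^sup>+t. (if 0 \<le> t \<and> t < g x then 1 else 0) \<partial>lborel)"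
      using g(1)[of x] by simp
  qed
  also have "\<dots> = (\<integral>\<^sup>+t. \<integral>\<^sup>+x. (if 0 \<le> t \<and> t < g x then 1 else 0) \<partial>\<mu> \<partial>lborel)"
    by (rule L.Fubini'[symmetric]) measurable
  finally have 1: "(\<integral>\<^sup>+x. ennreal (g x) \<partial>\<mu>) = (\<integral>\<^sup>+t. \<integral>\<^sup>+x. (if 0 \<le> t \<and> t < g x then 1 else 0) \<partial>\<mu> \<partial>lborel)" .
  \<comment> \<open>The positive part of the difference is the length of the set of levels
    \<open>t\<close> that separate the two points, with the first point in
    \<open>{x. t < g x}\<close> and the second outside.\<close>
  have "(\<integral>\<^sup>+z. ennreal (g (fst z) - g (snd z)) \<partial>flow_measure)
    = (\<integral>\<^sup>+z. \<integral>\<^sup>+t. (if g (snd z) \<le> t \<and> t < g (fst z) then 1 else 0) \<partial>lborel \<partial>flow_measure)"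
  proof (intro nn_integral_cong)
    fix z
    have "(\<integral>\<^sup>+t. (if g (snd z) \<le> t \<and> t < g (fst z) then 1 else 0) \<partial>lborel)
        = (\<integral>\<^sup>+t. indicator {g (snd z)..<g (fst z)} t \<partial>lborel)"
      by (intro nn_integral_cong) auto
    then show "ennreal (g (fst z) - g (snd z)) = (\<integral>\<^sup>+t. (if g (snd z) \<le> t \<and> t < g (fst z) then 1 else 0) \<partial>lborel)"
      by (cases "g (snd z) \<le> g (fst z)") (auto simp: ennreal_neg)
  qed
  also have "\<dots> = (\<integral>\<^sup>+t. \<integral>\<^sup>+z. (if g (snd z) \<le> t \<and> t < g (fst z) then 1 else 0) \<partial>flow_measure \<partial>lborel)"
    by (rule M.Fubini'[symmetric]) measurable
  finally have 2: "(\<integral>\<^sup>+z. ennreal (g (fst z) - g (snd z)) \<partial>flow_measure)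
    = (\<integral>\<^sup>+t. \<integral>\<^sup>+z. (if g (snd z) \<le> t \<and> t < g (fst z) then 1 else 0) \<partial>flow_measure \<partial>lborel)" .
  have "ennreal p * (\<integral>\<^sup>+x. ennreal (g x) \<partial>\<mu>)
     = (\<integral>\<^sup>+t. ennreal p * (\<integral>\<^sup>+x. (if 0 \<le> t \<and> t < g x then 1 else 0) \<partial>\<mu>) \<partial>lborel)"
    unfolding 1 by (rule nn_integral_cmult[symmetric]) measurable
  also have "\<dots> \<le> (\<integral>\<^sup>+t. (\<integral>\<^sup>+z. (if g (snd z) \<le> t \<and> t < g (fst z) then 1 else 0) \<partial>flow_measure)
      + ennreal (p * s) * indicator {0..<B} t \<partial>lborel)"
  proof (intro nn_integral_mono)
    \<comment> \<open>Superlevel sets at levels \<open>t \<ge> 0\<close> lie in the support of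
      \<open>g\<close> and so obey the volume bound. Outside [0, B) the left side is 0, hence the
      error \<open>p * s\<close> accumulates only over a length \<open>B\<close>.\<close>
    fix t :: real
    show "ennreal p * (\<integral>\<^sup>+x. (if 0 \<le> t \<and> t < g x then 1 else 0) \<partial>\<mu>)
      \<le> (\<integral>\<^sup>+z. (if g (snd z) \<le> t \<and> t < g (fst z) then 1 else 0) \<partial>flow_measure) + ennreal (p * s) * indicator {0..<B} t"
    proof (cases "0 \<le> t \<and> t < B")
      case True
      let ?S = "{x. t < g x}"
      have S: "?S \<in> sets borel" by measurable
      have "measure \<mu> ?S \<le> measure \<mu> {x. 0 < g x}"
        using True by (intro mu.finite_measure_mono) auto
      then have *: "measure \<mu> ?S \<le> v" using v by linarith
      have "(\<integral>\<^sup>+x. (if 0 \<le> t \<and> t < g x then 1 else 0) \<partial>\<mu>) = (\<integral>\<^sup>+x. indicator ?S x \<partial>\<mu>)"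
        using True by (intro nn_integral_cong) auto
      also have "\<dots> = emeasure \<mu> ?S" using S by simp
      finally have a: "(\<integral>\<^sup>+x. (if 0 \<le> t \<and> t < g x then 1 else 0) \<partial>\<mu>) = emeasure \<mu> ?S" .
      have b: "(\<integral>\<^sup>+z. (if g (snd z) \<le> t \<and> t < g (fst z) then 1 else 0) \<partial>flow_measure) = ergodic_flow \<mu> T ?S"
        unfolding flow_ergodic[OF S] by (intro nn_integral_cong) (auto simp: indicator_def)
      show ?thesis
        unfolding a b using conductance_ineq[OF S * assms(5,6) p] True by simp
    next
      case False
      have "\<not> (0 \<le> t \<and> t < g x)" for x using False g(2)[of x] by linarith
      then have "(\<integral>\<^sup>+x. (if 0 \<le> t \<and> t < g x then 1 else 0) \<partial>\<mu>) = (\<integral>\<^sup>+x. 0 \<partial>\<mu>)"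
        by (intro nn_integral_cong if_not_P)
      then show ?thesis by simp
    qed
  qed
  also have "\<dots> = (\<integral>\<^sup>+z. ennreal (g (fst z) - g (snd z)) \<partial>flow_measure) + ennreal (p * s * B)"
    unfolding 2 using B assms by (subst nn_integral_add) (auto simp: nn_integral_cmult ennreal_mult)
  finally show ?thesis .
qed

definition dirichlet :: "('a \<Rightarrow> real) \<Rightarrow> real" where
  "dirichlet f = (\<integral>z. (f (fst z) - f (snd z))\<^sup>2 \<partial>flow_measure) / 2"

lemma integrable_flow_diff_sq:
  fixes f :: "'a \<Rightarrow> real"
  assumes [measurable]: "f \<in> borel_measurable borel" and f: "\<And>x. \<bar>f x\<bar> \<le> B"
  shows "integrable flow_measure (\<lambda>z. (f (fst z) - f (snd z))\<^sup>2)"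
proof (rule bounded_integrable_flow)
  fix z :: "'a \<times> 'a"
  have "\<bar>f (fst z) - f (snd z)\<bar> \<le> 2 * B" using f[of "fst z"] f[of "snd z"] by linarith
  then show "\<bar>(f (fst z) - f (snd z))\<^sup>2\<bar> \<le> (2 * B)\<^sup>2" by (rule abs_power2_le)
qed simp

lemma dirichlet_nonneg: "0 \<le> dirichlet f"
  unfolding dirichlet_def by simp

text \<open>Apply coarea to the square of \<open>f\<close>. Factoring the difference of squares and
  a weighted AM-GM inequality bound the flow by the Dirichlet form plus half of the left side, which
  is absorbed. The loss \<open>2 * s * b\<^sup>2\<close> is twice the coarea error, relative to
  \<open>p\<close>.\<close>

lemma cheeger:
  fixes f :: "'a \<Rightarrow> real"
  assumes [measurable]: "f \<in> borel_measurable borel" and f: "\<And>x. 0 \<le> f x" "\<And>x. f x \<le> b"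
    and v: "measure \<mu> {x. 0 < f x} \<le> v" and p0: "0 \<le> p" and s0: "0 \<le> s"
    and p: "ennreal p \<le> conductance_profile \<mu> T s v"
  shows "p\<^sup>2 / 2 * ((\<integral>x. (f x)\<^sup>2 \<partial>\<mu>) - 2 * s * b\<^sup>2) \<le> dirichlet f"
proof (cases "p = 0")
  case True
  then show ?thesis by (simp add: dirichlet_nonneg)
next
  case False
  then have pp: "0 < p" using p0 by simp
  \<comment> \<open>Coarea sees only the positive part. Adding its swapped copy gives the absolute
    value, and by symmetry of the flow both have the same integral.\<close>
  define pos where "pos z = max 0 ((f (fst z))\<^sup>2 - (f (snd z))\<^sup>2)" for z :: "'a \<times> 'a"
  have [measurable]: "pos \<in> borel_measurable (borel \<Otimes>\<^sub>M borel)" unfolding pos_def by measurable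
  have fb: "\<bar>f x\<bar> \<le> b" for x using f[of x] by simp
  have f2: "(f x)\<^sup>2 \<le> b\<^sup>2" for x using f[of x] by (simp add: power_mono)
  have b0: "0 \<le> b" using f[of undefined] by linarith
  have i2: "integrable \<mu> (\<lambda>x. (f x)\<^sup>2)"
    by (rule bounded_integrable_mu[where B = "b\<^sup>2"]) (use f2 in auto)
  have i2a: "integrable flow_measure (\<lambda>z. (f (fst z))\<^sup>2)" "integrable flow_measure (\<lambda>z. (f (snd z))\<^sup>2)"
    by (rule bounded_integrable_flow[where B = "b\<^sup>2"], use f2 in auto)+
  have sq: "\<bar>max 0 (u - w\<^sup>2)\<bar> \<le> b\<^sup>2" if "u \<le> b\<^sup>2" for u w :: real
    using that zero_le_power2[of w] zero_le_power2[of b] by linarith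
  have ip: "integrable flow_measure pos" "integrable flow_measure (\<lambda>z. pos (snd z, fst z))"
    by (rule bounded_integrable_flow[where B = "b\<^sup>2"], simp, simp only: pos_def sq f2)+
  have "{x. 0 < (f x)\<^sup>2} = {x. 0 < f x}" using f(1) by (auto simp: less_le)
  then have "ennreal p * (\<integral>\<^sup>+x. ennreal ((f x)\<^sup>2) \<partial>\<mu>)
    \<le> (\<integral>\<^sup>+z. ennreal ((f (fst z))\<^sup>2 - (f (snd z))\<^sup>2) \<partial>flow_measure) + ennreal (p * s * b\<^sup>2)"
    using v p0 s0 p f2 by (intro coarea_conductance[where v = v]) auto
  moreover have "(\<integral>\<^sup>+x. ennreal ((f x)\<^sup>2) \<partial>\<mu>) = ennreal (\<integral>x. (f x)\<^sup>2 \<partial>\<mu>)"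
    using i2 by (intro nn_integral_eq_integral) auto
  moreover have "(\<integral>\<^sup>+z. ennreal ((f (fst z))\<^sup>2 - (f (snd z))\<^sup>2) \<partial>flow_measure) = (\<integral>\<^sup>+z. ennreal (pos z) \<partial>flow_measure)"
    by (intro nn_integral_cong) (auto simp: pos_def max_def ennreal_neg)
  moreover have "(\<integral>\<^sup>+z. ennreal (pos z) \<partial>flow_measure) = ennreal (\<integral>z. pos z \<partial>flow_measure)"
    by (intro nn_integral_eq_integral ip(1)) (simp add: pos_def)
  moreover have Fp: "0 \<le> (\<integral>z. pos z \<partial>flow_measure)" by (intro integral_nonneg_AE) (auto simp: pos_def)
  ultimately have c: "p * (\<integral>x. (f x)\<^sup>2 \<partial>\<mu>) \<le> (\<integral>z. pos z \<partial>flow_measure) + p * s * b\<^sup>2"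
    using p0 s0 by (simp add: ennreal_mult[symmetric] ennreal_plus[symmetric] del: ennreal_plus)
  have pw: "pos z + pos (snd z, fst z) \<le> (f (fst z) - f (snd z))\<^sup>2 / p + p / 2 * ((f (fst z))\<^sup>2 + (f (snd z))\<^sup>2)" for z
  proof -
    define x y where "x = f (fst z)" and "y = f (snd z)"
    have "pos z + pos (snd z, fst z) = \<bar>x\<^sup>2 - y\<^sup>2\<bar>" by (auto simp: pos_def x_def y_def)
    also have "\<dots> = \<bar>x - y\<bar> * \<bar>x + y\<bar>" by (simp add: abs_mult[symmetric] power2_eq_square algebra_simps)
    \<comment> \<open>AM-GM with the weight chosen so that, after (x + y)^2 \<le> 2 (x^2 + y^2), the
      second term integrates to \<open>p\<close> times the integral of the square: half of what the
      left side carries.\<close>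
    also have "\<dots> \<le> (x - y)\<^sup>2 / p + p / 4 * (x + y)\<^sup>2"
    proof -
      have "0 \<le> (\<bar>x - y\<bar> - p / 2 * \<bar>x + y\<bar>)\<^sup>2 / p" using pp by simp
      also have "\<dots> = (x - y)\<^sup>2 / p + p / 4 * (x + y)\<^sup>2 - \<bar>x - y\<bar> * \<bar>x + y\<bar>"
        using pp by (simp add: power2_diff power_mult_distrib field_simps) (simp add: power2_eq_square)
      finally show ?thesis by simp
    qed
    also have "\<dots> \<le> (x - y)\<^sup>2 / p + p / 2 * (x\<^sup>2 + y\<^sup>2)"
    proof -
      have "(x + y)\<^sup>2 \<le> 2 * (x\<^sup>2 + y\<^sup>2)" using sum_squares_bound[of x y] by (simp add: power2_sum)
      then have "p / 4 * (x + y)\<^sup>2 \<le> p / 4 * (2 * (x\<^sup>2 + y\<^sup>2))" using pp by (intro mult_left_mono) auto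
      then show ?thesis by (simp add: algebra_simps)
    qed
    finally show ?thesis by (simp add: x_def y_def)
  qed
  have "2 * (\<integral>z. pos z \<partial>flow_measure) = (\<integral>z. pos z + pos (snd z, fst z) \<partial>flow_measure)"
    using ip integral_flow_swap[of pos] by simp
  also have "\<dots> \<le> (\<integral>z. (f (fst z) - f (snd z))\<^sup>2 / p + p / 2 * ((f (fst z))\<^sup>2 + (f (snd z))\<^sup>2) \<partial>flow_measure)"
    using ip i2a integrable_flow_diff_sq[OF assms(1) fb] by (intro integral_mono pw) auto
  also have "\<dots> = 2 * dirichlet f / p + p * (\<integral>x. (f x)\<^sup>2 \<partial>\<mu>)"
    using i2a integrable_flow_diff_sq[OF assms(1) fb] integral_flow_fst[of "\<lambda>x. (f x)\<^sup>2"] integral_flow_snd[of "\<lambda>x. (f x)\<^sup>2"]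
    by (simp add: dirichlet_def)
  finally have "p * (\<integral>x. (f x)\<^sup>2 \<partial>\<mu>) \<le> 2 * dirichlet f / p + 2 * (p * s * b\<^sup>2)" using c by simp
  then have "p * (p * (\<integral>x. (f x)\<^sup>2 \<partial>\<mu>)) \<le> p * (2 * dirichlet f / p + 2 * (p * s * b\<^sup>2))"
    using pp by (intro mult_left_mono) auto
  then show ?thesis using pp by (simp add: algebra_simps power2_eq_square)
qed

text \<open>Serves two decompositions of \<open>h\<close>: the parts above and below a median, and a
  single truncation with \<open>g = 0\<close>.\<close>

lemma dirichlet_split_le:
  fixes f g h :: "'a \<Rightarrow> real"
  assumes [measurable]: "f \<in> borel_measurable borel" "g \<in> borel_measurable borel" "h \<in> borel_measurable borel"
    and "\<And>x. \<bar>f x\<bar> \<le> B" "\<And>x. \<bar>g x\<bar> \<le> B" "\<And>x. \<bar>h x\<bar> \<le> B"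
    and le: "\<And>x y. (f x - f y)\<^sup>2 + (g x - g y)\<^sup>2 \<le> (h x - h y)\<^sup>2"
  shows "dirichlet f + dirichlet g \<le> dirichlet h"
proof -
  note i = integrable_flow_diff_sq[OF assms(1,4)] integrable_flow_diff_sq[OF assms(2,5)] integrable_flow_diff_sq[OF assms(3,6)]
  have "(\<integral>z. (f (fst z) - f (snd z))\<^sup>2 + (g (fst z) - g (snd z))\<^sup>2 \<partial>flow_measure) \<le> (\<integral>z. (h (fst z) - h (snd z))\<^sup>2 \<partial>flow_measure)"
    using i le by (intro integral_mono) auto
  then show ?thesis using i by (simp add: dirichlet_def)
qed

text \<open>The cases divide at V = 8, where \<open>4 / V\<close> passes 1/2, so that
  \<open>min\<close> reduces to one argument. For large \<open>V\<close> one truncation carries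
  enough of the second moment; for small \<open>V\<close> the two parts about a median together
  carry at least the variance.\<close>

lemma dirichlet_ge_conductance:
  fixes h :: "'a \<Rightarrow> real"
  defines "V \<equiv> (\<integral>x. (h x)\<^sup>2 \<partial>\<mu>) - 1"
  assumes [measurable]: "h \<in> borel_measurable borel" and h: "\<And>x. 0 \<le> h x" "\<And>x. h x \<le> B"
    and h1: "(\<integral>x. h x \<partial>\<mu>) = 1" and p0: "0 \<le> p" and s0: "0 \<le> s"
    and V0: "0 < V" and sV: "16 * (s * B\<^sup>2) \<le> V" and s1: "2 * (s * B\<^sup>2) \<le> 1"
    and p: "ennreal p \<le> conductance_profile \<mu> T s (min (1 / 2) (4 / V))"
  shows "p\<^sup>2 * V / 4 \<le> dirichlet h"
proof -
  have hb: "\<bar>h x\<bar> \<le> B" for x using h[of x] by simp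
  have b0: "0 \<le> B" using h[of undefined] by linarith
  have ih: "integrable \<mu> h" by (rule bounded_integrable_mu[OF _ hb]) simp
  have ih2: "integrable \<mu> (\<lambda>x. (h x)\<^sup>2)"
    by (rule bounded_integrable_mu[OF _ abs_power2_le[OF hb]]) simp
  show ?thesis
  proof (cases "8 \<le> V")
    case True
    \<comment> \<open>Since \<open>h\<close> has mean 1, Markov's inequality bounds the measure of
      the support of this truncation by \<open>4 / V\<close>.\<close>
    define f where "f x = max 0 (h x - V / 4)" for x
    have [measurable]: "f \<in> borel_measurable borel" unfolding f_def by measurable
    have f: "0 \<le> f x" "f x \<le> B" for x using h[of x] b0 V0 by (auto simp: f_def)
    have fb: "\<bar>f x\<bar> \<le> B" for x using f[of x] by simp
    have if2: "integrable \<mu> (\<lambda>x. (f x)\<^sup>2)"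
      by (rule bounded_integrable_mu[OF _ abs_power2_le[OF fb]]) simp
    have "measure \<mu> {x. 0 < f x} \<le> measure \<mu> {x \<in> space \<mu>. V / 4 \<le> h x}"
      by (intro mu.finite_measure_mono) (auto simp: f_def)
    also have "\<dots> \<le> (\<integral>x. h x \<partial>\<mu>) / (V / 4)"
      using ih h(1) True by (intro integral_Markov_inequality_measure[where A = "{}"]) auto
    finally have m: "measure \<mu> {x. 0 < f x} \<le> 4 / V" by (simp add: h1)
    have "4 / V \<le> 1 / 2" using True by (simp add: field_simps)
    then have p': "ennreal p \<le> conductance_profile \<mu> T s (4 / V)" using p by (simp add: min_def split: if_splits)
    \<comment> \<open>The left integrand is nonpositive where \<open>f\<close> vanishes. Its
      integral is 1 + V/2, and the 1 pays for the Cheeger loss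
      \<open>2 * s * B\<^sup>2\<close>.\<close>
    have "(\<integral>x. (h x)\<^sup>2 - V / 2 * h x \<partial>\<mu>) \<le> (\<integral>x. (f x)\<^sup>2 \<partial>\<mu>)"
    proof (intro integral_mono)
      fix x
      show "(h x)\<^sup>2 - V / 2 * h x \<le> (f x)\<^sup>2"
      proof (cases "V / 4 \<le> h x")
        case True
        then have "(f x)\<^sup>2 = (h x)\<^sup>2 - V / 2 * h x + (V / 4)\<^sup>2" by (simp add: f_def power2_diff)
        then show ?thesis by simp
      next
        case False
        have "h x * (h x - V / 2) \<le> 0" using False h(1)[of x] V0 by (intro mult_nonneg_nonpos) auto
        then have "(h x)\<^sup>2 - V / 2 * h x \<le> 0" by (simp add: power2_eq_square algebra_simps)
        then show ?thesis by (smt (verit) zero_le_power2)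
      qed
    qed (use ih ih2 if2 in auto)
    moreover have "(\<integral>x. (h x)\<^sup>2 - V / 2 * h x \<partial>\<mu>) = 1 + V / 2"
      using ih ih2 h1 by (simp add: V_def field_simps)
    ultimately have F: "V / 2 \<le> (\<integral>x. (f x)\<^sup>2 \<partial>\<mu>) - 2 * s * B\<^sup>2" using s1 by (simp add: algebra_simps)
    have "p\<^sup>2 / 2 * (V / 2) \<le> p\<^sup>2 / 2 * ((\<integral>x. (f x)\<^sup>2 \<partial>\<mu>) - 2 * s * B\<^sup>2)"
      using F by (intro mult_left_mono) auto
    also have "\<dots> \<le> dirichlet f" by (rule cheeger[where f = f, OF _ f m p0 s0 p']) simp
    also have "\<dots> \<le> dirichlet f + dirichlet (\<lambda>x. 0)" by (simp add: dirichlet_nonneg)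
    also have "\<dots> \<le> dirichlet h"
    proof (rule dirichlet_split_le[where f = f and g = "\<lambda>x. 0" and h = h, OF _ _ _ fb _ hb])
      fix x y
      have "\<bar>f x - f y\<bar> \<le> \<bar>h x - h y\<bar>" unfolding f_def by linarith
      then show "(f x - f y)\<^sup>2 + (0 - 0)\<^sup>2 \<le> (h x - h y)\<^sup>2" by (simp add: abs_le_square_iff)
    qed (use b0 in auto)
    finally show ?thesis by simp
  next
    case False
    then have "1 / 2 \<le> 4 / V" using V0 by (simp add: field_simps)
    then have p': "ennreal p \<le> conductance_profile \<mu> T s (1 / 2)" using p by (simp add: min_def split: if_splits)
    obtain m where m: "0 \<le> m" "m \<le> B" "measure \<mu> {x \<in> space \<mu>. m < h x} \<le> 1 / 2" "measure \<mu> {x \<in> space \<mu>. h x < m} \<le> 1 / 2"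
      using mu.median_exists[of h B] h by auto
    define f where "f x = max 0 (h x - m)" for x
    define g where "g x = max 0 (m - h x)" for x
    have [measurable]: "f \<in> borel_measurable borel" "g \<in> borel_measurable borel" unfolding f_def g_def by measurable
    have f: "0 \<le> f x" "f x \<le> B" for x using h[of x] b0 m by (auto simp: f_def)
    have g: "0 \<le> g x" "g x \<le> B" for x using h[of x] b0 m by (auto simp: g_def)
    have fb: "\<bar>f x\<bar> \<le> B" for x using f[of x] by simp
    have gb: "\<bar>g x\<bar> \<le> B" for x using g[of x] by simp
    have mf: "measure \<mu> {x. 0 < f x} \<le> 1 / 2" and mg: "measure \<mu> {x. 0 < g x} \<le> 1 / 2"
      using m(3,4) by (simp_all add: f_def g_def less_max_iff_disj)
    have i: "integrable \<mu> (\<lambda>x. (f x)\<^sup>2)" "integrable \<mu> (\<lambda>x. (g x)\<^sup>2)"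
      by (rule bounded_integrable_mu[OF _ abs_power2_le[OF fb]] bounded_integrable_mu[OF _ abs_power2_le[OF gb]], simp)+
    \<comment> \<open>The supports are disjoint, so the squares add up to the squared deviation from
      \<open>m\<close>, whose integral is V + (1 - m)^2 as \<open>h\<close> has mean 1. The two
      Cheeger losses total \<open>4 * s * B\<^sup>2\<close>, at most V/4.\<close>
    have "(\<integral>x. (f x)\<^sup>2 \<partial>\<mu>) + (\<integral>x. (g x)\<^sup>2 \<partial>\<mu>) = (\<integral>x. (f x)\<^sup>2 + (g x)\<^sup>2 \<partial>\<mu>)" using i by simp
    also have "\<dots> = (\<integral>x. (h x)\<^sup>2 - 2 * m * h x + m\<^sup>2 \<partial>\<mu>)"
      by (intro Bochner_Integration.integral_cong) (auto simp: f_def g_def max_def power2_eq_square algebra_simps)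
    also have "\<dots> = (V + 1) - 2 * m + m\<^sup>2" using ih ih2 h1 by (simp add: V_def mu.prob_space[simplified])
    also have "\<dots> = V + (1 - m)\<^sup>2" by (simp add: power2_diff)
    finally have "V \<le> (\<integral>x. (f x)\<^sup>2 \<partial>\<mu>) + (\<integral>x. (g x)\<^sup>2 \<partial>\<mu>)" by simp
    then have "V / 2 \<le> ((\<integral>x. (f x)\<^sup>2 \<partial>\<mu>) - 2 * s * B\<^sup>2) + ((\<integral>x. (g x)\<^sup>2 \<partial>\<mu>) - 2 * s * B\<^sup>2)"
      using sV V0 by simp
    then have "p\<^sup>2 / 2 * (V / 2) \<le> p\<^sup>2 / 2 * (((\<integral>x. (f x)\<^sup>2 \<partial>\<mu>) - 2 * s * B\<^sup>2) + ((\<integral>x. (g x)\<^sup>2 \<partial>\<mu>) - 2 * s * B\<^sup>2))"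
      by (intro mult_left_mono) auto
    also have "\<dots> = p\<^sup>2 / 2 * ((\<integral>x. (f x)\<^sup>2 \<partial>\<mu>) - 2 * s * B\<^sup>2) + p\<^sup>2 / 2 * ((\<integral>x. (g x)\<^sup>2 \<partial>\<mu>) - 2 * s * B\<^sup>2)"
      by (simp only: distrib_left)
    also have "\<dots> \<le> dirichlet f + dirichlet g"
      using cheeger[where f = f, OF _ f mf p0 s0 p'] cheeger[where f = g, OF _ g mg p0 s0 p'] by (intro add_mono) auto
    also have "\<dots> \<le> dirichlet h"
    proof (rule dirichlet_split_le[where f = f and g = g and h = h, OF _ _ _ fb gb hb])
      fix x y
      \<comment> \<open>From f - g = h - m and f g = 0, the increments of \<open>f\<close> and
        \<open>g\<close> have nonpositive product, so the squared increment of \<open>h\<close>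
        dominates the sum of their squares.\<close>
      have fg: "f x - f y - (g x - g y) = h x - h y" unfolding f_def g_def by linarith
      have z: "f w * g w = 0" for w by (simp add: f_def g_def max_def)
      have "(f x - f y) * (g x - g y) = - (f x * g y + f y * g x)"
        unfolding left_diff_distrib right_diff_distrib z by simp
      moreover have "0 \<le> f x * g y + f y * g x" using f(1) g(1) by simp
      ultimately have "(f x - f y) * (g x - g y) \<le> 0" by linarith
      then show "(f x - f y)\<^sup>2 + (g x - g y)\<^sup>2 \<le> (h x - h y)\<^sup>2"
        unfolding fg[symmetric] power2_diff[of "f x - f y"] mult.assoc by linarith
    qed auto
    finally show ?thesis by simp
  qed
qed

section \<open>Evolution of the density\<close>

text \<open>The action of the kernel on functions. By reversibility it is also the evolution of
  densities with respect to \<open>\<mu>\<close>.\<close>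

definition step :: "('a \<Rightarrow> real) \<Rightarrow> 'a \<Rightarrow> real" where
  "step h x = (\<integral>y. h y \<partial>T x)"

lemma step_measurable[measurable]:
  assumes "h \<in> borel_measurable borel"
  shows "step h \<in> borel_measurable borel"
  unfolding step_def
  by (intro measurable_compose[OF measurable_prob_algebraD[OF T_meas] integral_measurable_subprob_algebra]) (fact assms)

lemma step_bounds:
  assumes [measurable]: "h \<in> borel_measurable borel" and h: "\<And>x. 0 \<le> h x" "\<And>x. h x \<le> B"
  shows "0 \<le> step h x" "step h x \<le> B"
proof -
  have "integrable (T x) h" by (rule bounded_integrable_T[where B = B]) (use h in auto)
  then have "(\<integral>y. h y \<partial>T x) \<le> (\<integral>y. B \<partial>T x)" using h by (intro integral_mono) auto
  then show "step h x \<le> B" using T.prob_space[of x] by (simp add: step_def)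
  show "0 \<le> step h x" unfolding step_def using h by (intro integral_nonneg_AE) auto
qed

lemma ennreal_step:
  assumes [measurable]: "h \<in> borel_measurable borel" and h: "\<And>x. 0 \<le> h x" "\<And>x. h x \<le> B"
  shows "ennreal (step h x) = (\<integral>\<^sup>+y. ennreal (h y) \<partial>T x)"
proof -
  have "integrable (T x) h" by (rule bounded_integrable_T[where B = B]) (use h in auto)
  then show ?thesis unfolding step_def using h by (intro nn_integral_eq_integral[symmetric]) auto
qed

text \<open>Mass weighted by \<open>h\<close> moves from the first to the second coordinate of the
  flow measure. Swapping the coordinates turns the incoming mass at \<open>x\<close> into the
  average of \<open>h\<close> over \<open>T x\<close>, which is \<open>step h x\<close>.\<close>

lemma bind_density:
  fixes h :: "'a \<Rightarrow> real"
  assumes [measurable]: "h \<in> borel_measurable borel" and h: "\<And>x. 0 \<le> h x" "\<And>x. h x \<le> B"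
  shows "density \<mu> (\<lambda>x. ennreal (h x)) \<bind> T = density \<mu> (\<lambda>x. ennreal (step h x))"
proof (rule measure_eqI)
  have Ts: "T \<in> density \<mu> (\<lambda>x. ennreal (h x)) \<rightarrow>\<^sub>M subprob_algebra borel"
    using measurable_prob_algebraD[OF T_meas] by simp
  have s: "sets (density \<mu> (\<lambda>x. ennreal (h x)) \<bind> T) = sets borel"
    by (rule sets_bind) auto
  then show "sets (density \<mu> (\<lambda>x. ennreal (h x)) \<bind> T) = sets (density \<mu> (\<lambda>x. ennreal (step h x)))"
    by simp
  fix A assume "A \<in> sets (density \<mu> (\<lambda>x. ennreal (h x)) \<bind> T)"
  then have A[measurable]: "A \<in> sets borel" using s by simp
  have [measurable]: "(\<lambda>x. emeasure (T x) A) \<in> borel_measurable borel"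
    using measurable_compose[OF measurable_prob_algebraD[OF T_meas] measurable_emeasure_subprob_algebra[OF A]] by simp
  have "emeasure (density \<mu> (\<lambda>x. ennreal (h x)) \<bind> T) A = (\<integral>\<^sup>+x. emeasure (T x) A \<partial>density \<mu> (\<lambda>x. ennreal (h x)))"
    by (rule emeasure_bind[OF _ Ts A]) simp
  also have "\<dots> = (\<integral>\<^sup>+x. ennreal (h x) * emeasure (T x) A \<partial>\<mu>)"
    by (rule nn_integral_density) measurable
  also have "\<dots> = (\<integral>\<^sup>+x. \<integral>\<^sup>+y. ennreal (h x) * indicator A y \<partial>T x \<partial>\<mu>)"
    by (intro nn_integral_cong) (simp add: nn_integral_cmult)
  also have "\<dots> = (\<integral>\<^sup>+z. ennreal (h (fst z)) * indicator A (snd z) \<partial>flow_measure)"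
    by (subst nn_integral_flow) auto
  also have "\<dots> = (\<integral>\<^sup>+z. ennreal (h (snd z)) * indicator A (fst z) \<partial>flow_measure)"
    by (subst nn_integral_flow_swap[symmetric]) auto
  also have "\<dots> = (\<integral>\<^sup>+x. \<integral>\<^sup>+y. ennreal (h y) * indicator A x \<partial>T x \<partial>\<mu>)"
    by (subst nn_integral_flow) auto
  also have "\<dots> = (\<integral>\<^sup>+x. ennreal (step h x) * indicator A x \<partial>\<mu>)"
    by (intro nn_integral_cong) (simp add: nn_integral_multc ennreal_step[OF assms])
  also have "\<dots> = emeasure (density \<mu> (\<lambda>x. ennreal (step h x))) A"
    by (rule emeasure_density[symmetric]) measurable
  finally show "emeasure (density \<mu> (\<lambda>x. ennreal (h x)) \<bind> T) A = emeasure (density \<mu> (\<lambda>x. ennreal (step h x))) A" .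
qed

section \<open>Dirichlet form and decay of the second moment in one step\<close>

lemma integral_flow_prod:
  fixes h :: "'a \<Rightarrow> real"
  assumes [measurable]: "h \<in> borel_measurable borel" and h: "\<And>x. 0 \<le> h x" "\<And>x. h x \<le> B"
  shows "(\<integral>z. h (fst z) * h (snd z) \<partial>flow_measure) = (\<integral>x. h x * step h x \<partial>\<mu>)"
proof -
  have "(\<integral>z. h (fst z) * h (snd z) \<partial>flow_measure) = enn2real (\<integral>\<^sup>+z. ennreal (h (fst z) * h (snd z)) \<partial>flow_measure)"
    using h by (intro integral_eq_nn_integral) auto
  also have "(\<integral>\<^sup>+z. ennreal (h (fst z) * h (snd z)) \<partial>flow_measure) = (\<integral>\<^sup>+x. \<integral>\<^sup>+y. ennreal (h x) * ennreal (h y) \<partial>T x \<partial>\<mu>)"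
    using h by (subst nn_integral_flow) (auto simp: ennreal_mult)
  also have "\<dots> = (\<integral>\<^sup>+x. ennreal (h x * step h x) \<partial>\<mu>)"
    using h step_bounds[OF assms] by (intro nn_integral_cong) (simp add: nn_integral_cmult ennreal_step[OF assms] ennreal_mult)
  also have "enn2real \<dots> = (\<integral>x. h x * step h x \<partial>\<mu>)"
    using h step_bounds[OF assms] by (intro integral_eq_nn_integral[symmetric]) auto
  finally show ?thesis .
qed

lemma integral_step:
  assumes [measurable]: "h \<in> borel_measurable borel" and h: "\<And>x. 0 \<le> h x" "\<And>x. h x \<le> B"
  shows "(\<integral>x. step h x \<partial>\<mu>) = (\<integral>x. h x \<partial>\<mu>)"
proof -
  have "(\<integral>x. step h x \<partial>\<mu>) = enn2real (\<integral>\<^sup>+x. ennreal (step h x) \<partial>\<mu>)"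
    using step_bounds[OF assms] by (intro integral_eq_nn_integral) auto
  also have "(\<integral>\<^sup>+x. ennreal (step h x) \<partial>\<mu>) = (\<integral>\<^sup>+z. ennreal (h (snd z)) \<partial>flow_measure)"
    by (subst nn_integral_flow) (auto simp: ennreal_step[OF assms])
  also have "enn2real \<dots> = (\<integral>z. h (snd z) \<partial>flow_measure)"
    using h by (intro integral_eq_nn_integral[symmetric]) auto
  finally show ?thesis by (simp add: integral_flow_snd)
qed

text \<open>Expand the square: both marginals of the flow measure are \<open>\<mu>\<close>, and the
  cross term pairs \<open>h\<close> with \<open>step h\<close>.\<close>

lemma dirichlet_eq:
  assumes [measurable]: "h \<in> borel_measurable borel" and h: "\<And>x. 0 \<le> h x" "\<And>x. h x \<le> B"
  shows "dirichlet h = (\<integral>x. (h x)\<^sup>2 \<partial>\<mu>) - (\<integral>x. h x * step h x \<partial>\<mu>)"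
proof -
  have B: "0 \<le> B" using h[of undefined] by linarith
  have h2: "(h x)\<^sup>2 \<le> B\<^sup>2" for x using h[of x] by (simp add: power_mono)
  have i: "integrable flow_measure (\<lambda>z. (h (fst z))\<^sup>2)" "integrable flow_measure (\<lambda>z. (h (snd z))\<^sup>2)"
    by (rule bounded_integrable_flow[where B = "B\<^sup>2"], use h2 in auto)+
  have i2: "integrable flow_measure (\<lambda>z. h (fst z) * h (snd z))"
    by (rule bounded_integrable_flow[where B = "B * B"]) (use h B in \<open>auto simp: abs_mult intro!: mult_mono\<close>)
  have "(\<integral>z. (h (fst z) - h (snd z))\<^sup>2 \<partial>flow_measure)
    = (\<integral>z. (h (fst z))\<^sup>2 + (h (snd z))\<^sup>2 - 2 * (h (fst z) * h (snd z)) \<partial>flow_measure)"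
    by (intro Bochner_Integration.integral_cong) (auto simp: power2_diff)
  also have "\<dots> = 2 * (\<integral>x. (h x)\<^sup>2 \<partial>\<mu>) - 2 * (\<integral>x. h x * step h x \<partial>\<mu>)"
    using i i2 integral_flow_fst[of "\<lambda>x. (h x)\<^sup>2"] integral_flow_snd[of "\<lambda>x. (h x)\<^sup>2"] integral_flow_prod[OF assms]
    by simp
  finally show ?thesis by (simp add: dirichlet_def)
qed

text \<open>Cauchy-Schwarz for \<open>h - h x\<close>: this function vanishes at \<open>x\<close>, so only the mass
  \<open>T x (- {x}) \<le> 1 - \<zeta>\<close> matters.\<close>

lemma lazy_contraction_pointwise:
  assumes [measurable]: "h \<in> borel_measurable borel" and h: "\<And>x. 0 \<le> h x" "\<And>x. h x \<le> B"
    and \<zeta>: "\<zeta> \<le> measure (T x) {x}" "\<zeta> < 1"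
  shows "(step h x)\<^sup>2 \<le> (1 - \<zeta>) * step (\<lambda>y. (h y)\<^sup>2) x + 2 * \<zeta> * (h x * step h x) - \<zeta> * (h x)\<^sup>2"
proof -
  define a where "a = step h x - h x"
  define c where "c = 1 - \<zeta>"
  have c: "0 < c" using \<zeta> by (simp add: c_def)
  have h2: "(h x)\<^sup>2 \<le> B\<^sup>2" for x using h[of x] by (simp add: power_mono)
  have ih: "integrable (T x) h" by (rule bounded_integrable_T[where B = B]) (use h in auto)
  have ih2: "integrable (T x) (\<lambda>y. (h y)\<^sup>2)" by (rule bounded_integrable_T[where B = "B\<^sup>2"]) (use h2 in auto)
  have ii: "integrable (T x) (indicator (- {x}) :: 'a \<Rightarrow> real)" by (rule bounded_integrable_T[where B = 1]) auto
  have q: "measure (T x) (- {x}) \<le> c"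
    using T.prob_compl[of "{x}" x] \<zeta> by (simp add: c_def Compl_eq_Diff_UNIV)
  \<comment> \<open>Cauchy-Schwarz as the integral of a square. The indicator drops out of the cross
    term, because h y - h x vanishes at \<open>y = x\<close>, and survives only in the last term,
    where its integral is at most \<open>c\<close>.\<close>
  have "0 \<le> (\<integral>y. (c * (h y - h x) - a * indicator (- {x}) y)\<^sup>2 \<partial>T x)" by simp
  also have "\<dots> = (\<integral>y. (c\<^sup>2 * (h y)\<^sup>2 - 2 * c\<^sup>2 * h x * h y + c\<^sup>2 * (h x)\<^sup>2) - (2 * c * a * h y - 2 * c * a * h x) + a\<^sup>2 * indicator (- {x}) y \<partial>T x)"
    by (intro Bochner_Integration.integral_cong) (auto simp: indicator_def power2_eq_square algebra_simps)
  also have "\<dots> = (c\<^sup>2 * step (\<lambda>y. (h y)\<^sup>2) x - 2 * c\<^sup>2 * h x * step h x + c\<^sup>2 * (h x)\<^sup>2) - (2 * c * a * step h x - 2 * c * a * h x) + a\<^sup>2 * measure (T x) (- {x})"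
    using ih ih2 ii by (simp add: step_def T.prob_space[simplified])
  also have "\<dots> \<le> (c\<^sup>2 * step (\<lambda>y. (h y)\<^sup>2) x - 2 * c\<^sup>2 * h x * step h x + c\<^sup>2 * (h x)\<^sup>2) - (2 * c * a * step h x - 2 * c * a * h x) + a\<^sup>2 * c"
    using q by (intro add_left_mono mult_left_mono) auto
  also have "\<dots> = c * (c * (step (\<lambda>y. (h y)\<^sup>2) x - 2 * h x * step h x + (h x)\<^sup>2) - a\<^sup>2)"
    by (simp add: a_def power2_eq_square algebra_simps)
  finally have "0 \<le> c * (step (\<lambda>y. (h y)\<^sup>2) x - 2 * h x * step h x + (h x)\<^sup>2) - a\<^sup>2"
    using c by (simp add: zero_le_mult_iff)
  then show ?thesis by (simp add: a_def c_def power2_eq_square algebra_simps)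
qed

text \<open>Integrate the pointwise contraction. Since \<open>step\<close> preserves integrals, the
  terms combine into the second moment of \<open>h\<close> minus \<open>2 * \<zeta>\<close> times
  the Dirichlet form.\<close>

lemma lazy_decay:
  assumes [measurable]: "h \<in> borel_measurable borel" and h: "\<And>x. 0 \<le> h x" "\<And>x. h x \<le> B"
    and \<zeta>: "\<And>x. \<zeta> \<le> measure (T x) {x}" "0 \<le> \<zeta>"
  shows "(\<integral>x. (step h x)\<^sup>2 \<partial>\<mu>) \<le> (\<integral>x. (h x)\<^sup>2 \<partial>\<mu>) - 2 * \<zeta> * dirichlet h"
proof -
  have B: "0 \<le> B" using h[of undefined] by linarith
  have h2: "(h x)\<^sup>2 \<le> B\<^sup>2" for x using h[of x] by (simp add: power_mono)
  note sb = step_bounds[OF assms(1-3)] and sb2 = step_bounds[of "\<lambda>x. (h x)\<^sup>2" "B\<^sup>2"]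
  have s2: "(step h x)\<^sup>2 \<le> B\<^sup>2" for x using sb[of x] by (simp add: power_mono)
  have i: "integrable \<mu> (\<lambda>x. (step h x)\<^sup>2)" "integrable \<mu> (\<lambda>x. (h x)\<^sup>2)"
    by (rule bounded_integrable_mu[where B = "B\<^sup>2"], use h2 s2 in auto)+
  have i2: "integrable \<mu> (\<lambda>x. h x * step h x)"
    by (rule bounded_integrable_mu[where B = "B * B"]) (use h B sb in \<open>auto simp: abs_mult intro!: mult_mono\<close>)
  have i3: "integrable \<mu> (step (\<lambda>x. (h x)\<^sup>2))"
    by (rule bounded_integrable_mu[where B = "B\<^sup>2"]) (use h2 sb2 in auto)
  \<comment> \<open>The pointwise bound requires a laziness strictly below 1, so it is applied with
    \<open>z * \<zeta>\<close> for \<open>z < 1\<close>, and \<open>z\<close> is sent to 1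
    afterwards.\<close>
  have "z * (2 * \<zeta> * dirichlet h) \<le> (\<integral>x. (h x)\<^sup>2 \<partial>\<mu>) - (\<integral>x. (step h x)\<^sup>2 \<partial>\<mu>)" if z: "0 < z" "z < 1" for z
  proof -
    have z1: "z * \<zeta> \<le> measure (T x) {x}" for x
      using \<zeta>(1)[of x] mult_left_le_one_le[of \<zeta> z] \<zeta>(2) z by simp
    have "\<zeta> \<le> 1" using \<zeta>(1)[of undefined] T.prob_le_1[of undefined "{undefined}"] by linarith
    then have z2: "z * \<zeta> < 1" using z \<zeta>(2) mult_left_le[of \<zeta> z] by linarith
    have "(\<integral>x. (step h x)\<^sup>2 \<partial>\<mu>) \<le> (\<integral>x. (1 - z * \<zeta>) * step (\<lambda>y. (h y)\<^sup>2) x + 2 * (z * \<zeta>) * (h x * step h x) - z * \<zeta> * (h x)\<^sup>2 \<partial>\<mu>)"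
      using i i2 i3 lazy_contraction_pointwise[OF assms(1-3) z1 z2] by (intro integral_mono) auto
    also have "\<dots> = (1 - z * \<zeta>) * (\<integral>x. (h x)\<^sup>2 \<partial>\<mu>) + 2 * (z * \<zeta>) * (\<integral>x. h x * step h x \<partial>\<mu>) - z * \<zeta> * (\<integral>x. (h x)\<^sup>2 \<partial>\<mu>)"
      using i i2 i3 integral_step[of "\<lambda>x. (h x)\<^sup>2" "B\<^sup>2"] h2 by simp
    also have "\<dots> = (\<integral>x. (h x)\<^sup>2 \<partial>\<mu>) - z * (2 * \<zeta> * dirichlet h)"
      by (simp add: dirichlet_eq[OF assms(1-3)] algebra_simps)
    finally show ?thesis by simp
  qed
  then have "2 * \<zeta> * dirichlet h \<le> (\<integral>x. (h x)\<^sup>2 \<partial>\<mu>) - (\<integral>x. (step h x)\<^sup>2 \<partial>\<mu>)"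
    by (rule field_le_mult_one_interval)
  then show ?thesis by simp
qed

section \<open>Chi-squared divergence and warm starts in terms of densities\<close>

lemma chi2_density:
  fixes h :: "'a \<Rightarrow> real"
  assumes [measurable]: "h \<in> borel_measurable borel" and h: "\<And>x. 0 \<le> h x" "\<And>x. h x \<le> B"
    and h1: "(\<integral>x. h x \<partial>\<mu>) = 1"
  shows "chi2_divergence (density \<mu> (\<lambda>x. ennreal (h x))) \<mu> = ennreal ((\<integral>x. (h x)\<^sup>2 \<partial>\<mu>) - 1)"
proof -
  have h2: "(h x)\<^sup>2 \<le> B\<^sup>2" for x using h[of x] by (simp add: power_mono)
  have i: "integrable \<mu> h" by (rule bounded_integrable_mu[where B = B]) (use h in auto)
  have i2: "integrable \<mu> (\<lambda>x. (h x)\<^sup>2)" by (rule bounded_integrable_mu[where B = "B\<^sup>2"]) (use h2 in auto)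
  have eq: "(h x - 1)\<^sup>2 = (h x)\<^sup>2 - 2 * h x + 1" for x by (simp add: power2_diff)
  have "absolutely_continuous \<mu> (density \<mu> (\<lambda>x. ennreal (h x)))" by (rule absolutely_continuousI_density) simp
  moreover have "AE x in \<mu>. ennreal (h x) = RN_deriv \<mu> (density \<mu> (\<lambda>x. ennreal (h x))) x"
    by (rule mu.RN_deriv_unique) auto
  then have "(\<integral>\<^sup>+x. ennreal ((enn2real (RN_deriv \<mu> (density \<mu> (\<lambda>x. ennreal (h x))) x) - 1)\<^sup>2) \<partial>\<mu>)
    = (\<integral>\<^sup>+x. ennreal ((h x - 1)\<^sup>2) \<partial>\<mu>)"
  proof (intro nn_integral_cong_AE, eventually_elim)
    fix x assume *: "ennreal (h x) = RN_deriv \<mu> (density \<mu> (\<lambda>x. ennreal (h x))) x"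
    show "ennreal ((enn2real (RN_deriv \<mu> (density \<mu> (\<lambda>x. ennreal (h x))) x) - 1)\<^sup>2) = ennreal ((h x - 1)\<^sup>2)"
      unfolding *[symmetric] by (simp add: h(1))
  qed
  moreover have "\<dots> = ennreal (\<integral>x. (h x - 1)\<^sup>2 \<partial>\<mu>)"
  proof (rule nn_integral_eq_integral)
    show "integrable \<mu> (\<lambda>x. (h x - 1)\<^sup>2)" using i i2 by (simp add: eq)
  qed simp
  moreover have "(\<integral>x. (h x - 1)\<^sup>2 \<partial>\<mu>) = (\<integral>x. (h x)\<^sup>2 \<partial>\<mu>) - 1"
    using i i2 h1 by (simp add: eq mu.prob_space[simplified])
  ultimately show ?thesis by (simp add: chi2_divergence_def)
qed

text \<open>Test the condition on the whole space. Below 1 there are thus no warm starts, and the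
  maximal mixing time is a supremum over the empty set.\<close>

lemma warm_start_bound_ge_1:
  assumes "\<nu> \<in> warm_starts B \<mu>"
  shows "1 \<le> B"
proof -
  have sp: "prob_space \<nu>" "sets \<nu> = sets borel" and w: "\<forall>E\<in>sets borel. measure \<nu> E \<le> B * measure \<mu> E"
    using assms by (auto simp: warm_starts_def space_prob_algebra)
  have "measure \<nu> UNIV = 1"
    using prob_space.prob_space[OF sp(1)] sets_eq_imp_space_eq[OF sp(2)] by simp
  then show ?thesis using bspec[OF w, of UNIV] mu.prob_space by simp
qed

text \<open>The warm start condition bounds the Radon-Nikodym derivative by \<open>B\<close> only
  almost everywhere. Capping it at \<open>B\<close> yields a version bounded everywhere, a property
  that \<open>step\<close> preserves.\<close>

lemma warm_density:
  assumes "\<nu> \<in> warm_starts B \<mu>"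
  obtains h where "h \<in> borel_measurable borel" "\<And>x. 0 \<le> h x" "\<And>x. h x \<le> B" "(\<integral>x. h x \<partial>\<mu>) = 1"
    "\<nu> = density \<mu> (\<lambda>x. ennreal (h x))"
proof -
  have s[simp]: "sets \<nu> = sets borel" and pn: "prob_space \<nu>" and w: "\<And>E. E \<in> sets borel \<Longrightarrow> measure \<nu> E \<le> B * measure \<mu> E"
    using assms by (auto simp: warm_starts_def space_prob_algebra)
  interpret N: prob_space \<nu> by fact
  have sp[simp]: "space \<nu> = UNIV" using sets_eq_imp_space_eq[OF s] by simp
  have B1: "1 \<le> B" by (rule warm_start_bound_ge_1[OF assms])
  have ac: "absolutely_continuous \<mu> \<nu>"
  proof (unfold absolutely_continuous_def, rule subsetI)
    fix E assume "E \<in> null_sets \<mu>"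
    then have E: "E \<in> sets borel" "measure \<mu> E = 0" by (auto simp: null_sets_def measure_def)
    then have "measure \<nu> E \<le> 0" using w[of E] by simp
    then have "emeasure \<nu> E = 0" by (simp add: N.emeasure_eq_measure measure_le_0_iff)
    then show "E \<in> null_sets \<nu>" using E by (simp add: null_sets_def)
  qed
  define r where "r = RN_deriv \<mu> \<nu>"
  have [measurable]: "r \<in> borel_measurable borel"
    unfolding r_def using borel_measurable_RN_deriv[of \<mu> \<nu>] by simp
  have dr: "density \<mu> r = \<nu>" unfolding r_def by (rule mu.density_RN_deriv[OF ac]) simp
  have rB: "AE x in \<mu>. r x \<le> ennreal B"
  proof -
    define E where "E = {x. ennreal B < r x}"
    have E[measurable]: "E \<in> sets borel" unfolding E_def by measurable
    have "emeasure \<nu> E = (\<integral>\<^sup>+x. r x * indicator E x \<partial>\<mu>)"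
      by (subst dr[symmetric], rule emeasure_density) auto
    moreover have "emeasure \<nu> E \<le> ennreal B * emeasure \<mu> E"
      using w[OF E] B1 by (simp add: N.emeasure_eq_measure mu.emeasure_eq_measure ennreal_mult[symmetric])
    moreover have "(\<integral>\<^sup>+x. ennreal B * indicator E x \<partial>\<mu>) = ennreal B * emeasure \<mu> E" by (simp add: nn_integral_cmult)
    ultimately have le: "(\<integral>\<^sup>+x. r x * indicator E x \<partial>\<mu>) \<le> (\<integral>\<^sup>+x. ennreal B * indicator E x \<partial>\<mu>)" by simp
    have fin: "(\<integral>\<^sup>+x. ennreal B * indicator E x \<partial>\<mu>) \<noteq> \<infinity>"
      by (simp add: nn_integral_cmult mu.emeasure_eq_measure ennreal_mult_eq_top_iff)
    \<comment> \<open>On \<open>E\<close> the derivative strictly exceeds \<open>B\<close>; were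
      \<open>E\<close> not null, \<open>\<nu>\<close> would give it more than \<open>B\<close> times
      its \<open>\<mu>\<close>-measure.\<close>
    have "\<not> (AE x in \<mu>. r x * indicator E x \<le> ennreal B * indicator E x) \<Longrightarrow> False"
      using nn_integral_less[of "\<lambda>x. ennreal B * indicator E x" \<mu> "\<lambda>x. r x * indicator E x"] fin le
      by (auto simp: E_def indicator_def not_le less_imp_le)
    then have "AE x in \<mu>. r x * indicator E x \<le> ennreal B * indicator E x" by blast
    then show ?thesis
    proof eventually_elim
      fix x assume "r x * indicator E x \<le> ennreal B * indicator E x"
      then show "r x \<le> ennreal B" by (intro leI notI) (simp add: E_def)
    qed
  qed
  define h where "h x = min B (enn2real (r x))" for x
  have hm[measurable]: "h \<in> borel_measurable borel" unfolding h_def by measurable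
  have h: "0 \<le> h x" "h x \<le> B" for x using B1 by (auto simp: h_def)
  have "AE x in \<mu>. ennreal (h x) = r x"
    using rB
  proof eventually_elim
    fix x assume x: "r x \<le> ennreal B"
    then have "enn2real (r x) \<le> B" using B1 enn2real_leI by fastforce
    moreover have "r x < top" using x by (rule order.strict_trans1) simp
    ultimately show "ennreal (h x) = r x" by (simp add: h_def)
  qed
  then have "density \<mu> (\<lambda>x. ennreal (h x)) = density \<mu> r" by (intro density_cong) auto
  then have nu: "\<nu> = density \<mu> (\<lambda>x. ennreal (h x))" by (simp add: dr)
  have "(\<integral>\<^sup>+x. ennreal (h x) \<partial>\<mu>) = emeasure \<nu> UNIV"
    unfolding nu by (subst emeasure_density) auto
  also have "\<dots> = 1" using N.emeasure_space_1 by simp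
  finally have "(\<integral>\<^sup>+x. ennreal (h x) \<partial>\<mu>) = 1" .
  then have "(\<integral>x. h x \<partial>\<mu>) = 1"
    using h by (subst integral_eq_nn_integral) auto
  with hm h nu show thesis using that by blast
qed

text \<open>The facts share one induction because the next law is again a density only by way of
  measurability, nonnegativity and boundedness of the current one.\<close>

lemma law_after_density:
  fixes h :: "'a \<Rightarrow> real"
  assumes [measurable]: "h \<in> borel_measurable borel" and h: "\<And>x. 0 \<le> h x" "\<And>x. h x \<le> B"
    and h1: "(\<integral>x. h x \<partial>\<mu>) = 1"
  shows "(step ^^ k) h \<in> borel_measurable borel \<and> (\<forall>x. 0 \<le> (step ^^ k) h x \<and> (step ^^ k) h x \<le> B)
    \<and> (\<integral>x. (step ^^ k) h x \<partial>\<mu>) = 1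
    \<and> law_after T k (density \<mu> (\<lambda>x. ennreal (h x))) = density \<mu> (\<lambda>x. ennreal ((step ^^ k) h x))"
proof (induction k)
  case 0
  then show ?case using assms by (simp add: law_after_def)
next
  case (Suc k)
  let ?g = "(step ^^ k) h"
  have g: "?g \<in> borel_measurable borel" "\<And>x. 0 \<le> ?g x" "\<And>x. ?g x \<le> B" using Suc by auto
  have "law_after T (Suc k) (density \<mu> (\<lambda>x. ennreal (h x))) = law_after T k (density \<mu> (\<lambda>x. ennreal (h x))) \<bind> T"
    by (simp add: law_after_def)
  then show ?case
    using Suc step_measurable[OF g(1)] step_bounds[OF g] integral_step[OF g] bind_density[OF g] by simp
qed

end

section \<open>From one step to the mixing time\<close>

text \<open>The last step may overshoot \<open>e\<close> by any amount (even \<open>W = 0\<close>), so the interval is cut off at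
  \<open>V = e / 2\<close>; this costs a factor 2.\<close>

lemma step_le_profile_integral:
  fixes \<Phi> :: "real \<Rightarrow> ennreal" and V W e \<zeta> :: real
  defines "G \<equiv> \<lambda>v. 1 / (ennreal v * (\<Phi> (min (1 / 2) v))\<^sup>2)"
  assumes anti: "antimono \<Phi>" and pos: "0 < \<Phi> (1 / 2)" and e: "0 < e" and V: "e < V" and W: "0 \<le> W" and \<zeta>: "0 < \<zeta>"
    and step: "\<And>p. 0 \<le> p \<Longrightarrow> ennreal p \<le> \<Phi> (min (1 / 2) (4 / V)) \<Longrightarrow> W \<le> V - \<zeta> / 2 * p\<^sup>2 * V"
  shows "1 \<le> ennreal (4 / \<zeta>) * (\<integral>\<^sup>+v\<in>{4 / V..<4 / max W (e / 2)}. G v \<partial>lborel)"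
proof -
  define P where "P = \<Phi> (min (1 / 2) (4 / V))"
  have V0: "0 < V" using e V by simp
  \<comment> \<open>As \<open>W\<close> is nonnegative, one step cannot remove more than
    \<open>V\<close>, which limits every admissible \<open>p\<close>.\<close>
  have c1: "\<zeta> / 2 * p\<^sup>2 \<le> 1" if "0 \<le> p" "ennreal p \<le> P" for p
  proof -
    have "\<zeta> / 2 * p\<^sup>2 * V \<le> 1 * V" using step[of p] that W by (simp add: P_def)
    then show ?thesis using V0 by (simp only: mult_le_cancel_right_pos)
  qed
  have "P \<noteq> top"
  proof
    assume "P = top"
    \<comment> \<open>Were the profile value infinite, every \<open>p\<close> would be admissible;
      this one gives \<zeta>/2 + 2 + 2/\<zeta>, which exceeds 1.\<close>
    then have "\<zeta> / 2 * (1 + 2 / \<zeta>)\<^sup>2 \<le> 1" using \<zeta> by (intro c1) auto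
    moreover have "\<zeta> / 2 * (1 + 2 / \<zeta>)\<^sup>2 = \<zeta> / 2 + 2 + 2 / \<zeta>" using \<zeta> by (simp add: field_simps power2_eq_square)
    moreover have "0 < 2 / \<zeta>" using \<zeta> by simp
    ultimately show False using \<zeta> by linarith
  qed
  then obtain p where p: "0 \<le> p" "P = ennreal p" by (cases P) auto
  have "0 < P" using pos antimonoD[OF anti, of "min (1 / 2) (4 / V)" "1 / 2"] unfolding P_def by (auto intro: order.strict_trans2)
  then have p0: "0 < p" using p by simp
  define c where "c = \<zeta> / 2 * p\<^sup>2"
  have c: "0 < c" "c \<le> 1" using c1[of p] p p0 \<zeta> by (auto simp: c_def)
  define u where "u = 4 / V"
  \<comment> \<open>The lower bound \<open>V / 2\<close> keeps \<open>X\<close> positive when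
    \<open>W = 0\<close>, and \<open>V / 2 > e / 2\<close> keeps [u, w) inside the interval of the
    statement.\<close>
  define X where "X = max W (V / 2)"
  define w where "w = 4 / X"
  have X0: "0 < X" using V0 by (simp add: X_def)
  have Wc: "W \<le> (1 - c) * V" using step[of p] p by (simp add: P_def c_def algebra_simps)
  \<comment> \<open>Replacing \<open>W\<close> by \<open>X\<close> costs half of the relative
    decrease: \<open>1 / 2 \<le> 1 - c / 2\<close> because \<open>c \<le> 1\<close>.\<close>
  have XV: "X / V \<le> 1 - c / 2"
  proof -
    have "(1 - c) * V \<le> (1 - c / 2) * V" "1 / 2 * V \<le> (1 - c / 2) * V" using c V0 by (intro mult_right_mono; simp)+
    then have "X \<le> (1 - c / 2) * V" using Wc unfolding X_def by linarith
    then show ?thesis using V0 by (simp add: field_simps)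
  qed
  have uw: "u / w = X / V" using X0 V0 by (simp add: u_def w_def)
  have w0: "0 < w" "0 < u" using X0 V0 by (simp_all add: w_def u_def)
  have ww: "w \<le> 4 / max W (e / 2)" unfolding w_def X_def using V e W by (intro divide_left_mono mult_pos_pos) auto
  have "u / w \<le> 1" using uw XV c by linarith
  then have ule: "u \<le> w" using w0 by simp
  \<comment> \<open>On [u, w) the integrand is at least 1/(w p^2) by antitonicity, and w - u \<ge> w
    c / 2. The product is at least c / (2 p^2) = \<zeta>/4.\<close>
  have "ennreal (\<zeta> / 4) \<le> ennreal (1 / (w * p\<^sup>2)) * ennreal (w - u)"
  proof -
    have "\<zeta> / 4 = c / 2 / p\<^sup>2" using p0 by (simp add: c_def)
    also have "\<dots> \<le> (1 - u / w) / p\<^sup>2" using XV uw by (intro divide_right_mono) auto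
    also have "\<dots> = 1 / (w * p\<^sup>2) * (w - u)" using w0 p0 by (simp add: field_simps)
    finally show ?thesis using w0 ule by (simp add: ennreal_mult'[symmetric] ennreal_leI)
  qed
  also have "\<dots> = (\<integral>\<^sup>+v. ennreal (1 / (w * p\<^sup>2)) * indicator {u..<w} v \<partial>lborel)"
    using ule by (simp add: nn_integral_cmult)
  also have "\<dots> \<le> (\<integral>\<^sup>+v. G v * indicator {u..<4 / max W (e / 2)} v \<partial>lborel)"
  proof (intro nn_integral_mono)
    fix v
    show "ennreal (1 / (w * p\<^sup>2)) * indicator {u..<w} v \<le> G v * indicator {u..<4 / max W (e / 2)} v"
    proof (cases "v \<in> {u..<w}")
      case True
      then have v: "u \<le> v" "v < w" "0 < v" using w0 by auto
      have "\<Phi> (min (1 / 2) v) \<le> P" unfolding P_def using v by (intro antimonoD[OF anti]) (auto simp: u_def min_def)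
      then have "ennreal v * (\<Phi> (min (1 / 2) v))\<^sup>2 \<le> ennreal w * P\<^sup>2"
        using v by (intro mult_mono power_mono ennreal_leI) auto
      then have "inverse (ennreal w * P\<^sup>2) \<le> G v" unfolding G_def divide_ennreal_def
        by (simp add: inverse_ennreal_antimono)
      moreover have "inverse (ennreal w * P\<^sup>2) = ennreal (1 / (w * p\<^sup>2))"
        unfolding p(2) using w0 p0 by (simp add: ennreal_power ennreal_mult[symmetric] inverse_ennreal inverse_eq_divide)
      ultimately show ?thesis using True ww v by simp
    qed simp
  qed
  finally have "ennreal (4 / \<zeta>) * ennreal (\<zeta> / 4) \<le> ennreal (4 / \<zeta>) * (\<integral>\<^sup>+v. G v * indicator {u..<4 / max W (e / 2)} v \<partial>lborel)"
    by (rule mult_left_mono) simp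
  then show ?thesis using \<zeta> by (simp add: ennreal_mult'[symmetric] u_def)
qed

text \<open>In the variable 4/V the intervals used by successive steps are adjacent, so their
  contributions of at least 1 each add up. They begin no earlier than \<open>4 / M\<close>, and the
  cut-off at \<open>e / 2\<close> ends them by \<open>8 / e\<close>.\<close>

lemma profile_recursion_count:
  fixes \<Phi> :: "real \<Rightarrow> ennreal" and V :: "nat \<Rightarrow> real" and e \<zeta> M :: real
  defines "G \<equiv> \<lambda>v. 1 / (ennreal v * (\<Phi> (min (1 / 2) v))\<^sup>2)"
  assumes anti: "antimono \<Phi>" and pos: "0 < \<Phi> (1 / 2)" and e: "0 < e" and V: "\<And>k. 0 \<le> V k" "V 0 \<le> M"
    and \<zeta>: "0 < \<zeta>"
    and step: "\<And>k p. e < V k \<Longrightarrow> 0 \<le> p \<Longrightarrow> ennreal p \<le> \<Phi> (min (1 / 2) (4 / V k)) \<Longrightarrow> V (Suc k) \<le> V k - \<zeta> / 2 * p\<^sup>2 * V k"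
    and j: "\<And>k. k < j \<Longrightarrow> e < V k"
  shows "of_nat j \<le> ennreal (4 / \<zeta>) * (\<integral>\<^sup>+v\<in>{4 / M..8 / e}. G v \<partial>lborel)"
proof -
  have [measurable]: "\<Phi> \<in> borel_measurable borel" by (rule borel_measurable_antimono_ennreal[OF anti])
  have [measurable]: "G \<in> borel_measurable borel" unfolding G_def by measurable
  have "V i \<le> M \<and> of_nat i \<le> ennreal (4 / \<zeta>) * (\<integral>\<^sup>+v\<in>{4 / M..<4 / max (V i) (e / 2)}. G v \<partial>lborel)" if "i \<le> j" for i
    using that
  proof (induction i)
    case 0
    then show ?case using V by simp
  next
    case (Suc i)
    then have IH: "V i \<le> M" "of_nat i \<le> ennreal (4 / \<zeta>) * (\<integral>\<^sup>+v\<in>{4 / M..<4 / max (V i) (e / 2)}. G v \<partial>lborel)"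
      and eV: "e < V i" using j by auto
    \<comment> \<open>Before stopping the cut-off is inactive, so the new interval begins where the
      previous one ended.\<close>
    have mx: "max (V i) (e / 2) = V i" using eV e by simp
    \<comment> \<open>The choice \<open>p = 0\<close> is always admissible and shows that
      \<open>V\<close> does not increase.\<close>
    have dec: "V (Suc i) \<le> V i" using step[OF eV, of 0] by simp
    have "1 \<le> ennreal (4 / \<zeta>) * (\<integral>\<^sup>+v\<in>{4 / V i..<4 / max (V (Suc i)) (e / 2)}. G v \<partial>lborel)"
      unfolding G_def by (rule step_le_profile_integral[OF anti pos e eV V(1) \<zeta> step[OF eV]])
    then have "of_nat i + 1 \<le> ennreal (4 / \<zeta>) * (\<integral>\<^sup>+v\<in>{4 / M..<4 / V i}. G v \<partial>lborel) + ennreal (4 / \<zeta>) * (\<integral>\<^sup>+v\<in>{4 / V i..<4 / max (V (Suc i)) (e / 2)}. G v \<partial>lborel)"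
      using IH(2) unfolding mx by (rule add_mono[rotated])
    also have "\<dots> = ennreal (4 / \<zeta>) * (\<integral>\<^sup>+v. G v * indicator {4 / M..<4 / V i} v + G v * indicator {4 / V i..<4 / max (V (Suc i)) (e / 2)} v \<partial>lborel)"
      by (subst nn_integral_add) (auto simp: distrib_left)
    also have "\<dots> \<le> ennreal (4 / \<zeta>) * (\<integral>\<^sup>+v\<in>{4 / M..<4 / max (V (Suc i)) (e / 2)}. G v \<partial>lborel)"
    proof (intro mult_left_mono nn_integral_mono)
      fix v
      have "4 / M \<le> 4 / V i" using IH(1) eV e by (intro divide_left_mono mult_pos_pos) auto
      moreover have "4 / V i \<le> 4 / max (V (Suc i)) (e / 2)" using dec eV e by (intro divide_left_mono mult_pos_pos) auto
      ultimately show "G v * indicator {4 / M..<4 / V i} v + G v * indicator {4 / V i..<4 / max (V (Suc i)) (e / 2)} v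
        \<le> G v * indicator {4 / M..<4 / max (V (Suc i)) (e / 2)} v"
        by (auto simp: indicator_def)
    qed simp
    finally show ?case using dec IH(1) by (simp add: add.commute)
  qed
  from this[of j] have "of_nat j \<le> ennreal (4 / \<zeta>) * (\<integral>\<^sup>+v\<in>{4 / M..<4 / max (V j) (e / 2)}. G v \<partial>lborel)" by simp
  also have "\<dots> \<le> ennreal (4 / \<zeta>) * (\<integral>\<^sup>+v\<in>{4 / M..8 / e}. G v \<partial>lborel)"
  proof (intro mult_left_mono nn_integral_mono mult_left_mono)
    fix v
    have "4 / max (V j) (e / 2) \<le> 4 / (e / 2)" using e by (intro divide_left_mono mult_pos_pos) auto
    then show "indicator {4 / M..<4 / max (V j) (e / 2)} v \<le> (indicator {4 / M..8 / e} v :: ennreal)" by auto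
  qed simp_all
  finally show ?thesis .
qed

text \<open>Split at 1/2. Beyond it the profile is frozen at its value there, so both integrals are
  logarithms times the same constant \<open>K\<close> and only the factors in front remain to be
  compared.\<close>

lemma profile_integral_le:
  fixes \<Phi> :: "real \<Rightarrow> ennreal" and \<epsilon> M :: real
  assumes anti: "antimono \<Phi>" and \<epsilon>: "0 < \<epsilon>" "\<epsilon> < 1" and \<zeta>: "0 < \<zeta>"
  shows "ennreal (4 / \<zeta>) * (\<integral>\<^sup>+v\<in>{4 / M..8 / \<epsilon>\<^sup>2}. 1 / (ennreal v * (\<Phi> (min (1 / 2) v))\<^sup>2) \<partial>lborel)
    \<le> ennreal (16 / \<zeta>) * (\<integral>\<^sup>+v\<in>{4 / M..1 / 2}. 1 / (ennreal v * (\<Phi> v)\<^sup>2) \<partial>lborel)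
      + ennreal (64 / \<zeta>) * (\<integral>\<^sup>+v\<in>{1 / 2..4 * sqrt 2 / \<epsilon>}. 1 / (ennreal v * (\<Phi> (1 / 2))\<^sup>2) \<partial>lborel)"
proof -
  have [measurable]: "\<Phi> \<in> borel_measurable borel" by (rule borel_measurable_antimono_ennreal[OF anti])
  define K where "K = inverse ((\<Phi> (1 / 2))\<^sup>2)"
  have int: "(\<integral>\<^sup>+v\<in>{1 / 2..b}. 1 / (ennreal v * (\<Phi> (1 / 2))\<^sup>2) \<partial>lborel) = ennreal (ln (b / (1 / 2))) * K" if "1 / 2 \<le> b" for b :: real
  proof -
    have "(\<integral>\<^sup>+v\<in>{1 / 2..b}. 1 / (ennreal v * (\<Phi> (1 / 2))\<^sup>2) \<partial>lborel) = (\<integral>\<^sup>+v. ennreal (1 / v) * indicator {1 / 2..b} v * K \<partial>lborel)"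
      by (intro nn_integral_cong) (auto simp: indicator_def K_def inverse_ennreal_mult_real)
    also have "\<dots> = (\<integral>\<^sup>+v\<in>{1 / 2..b}. ennreal (1 / v) \<partial>lborel) * K"
      by (rule nn_integral_multc) measurable
    finally show ?thesis using that by (simp add: nn_integral_inverse_Icc)
  qed
  have e2: "0 < \<epsilon>\<^sup>2" "\<epsilon>\<^sup>2 \<le> 1" using \<epsilon> by (auto simp: power_le_one)
  have b1: "1 / 2 \<le> 8 / \<epsilon>\<^sup>2" using e2 by (simp add: field_simps)
  have s2: "1 \<le> sqrt 2" by simp
  have b2: "1 / 2 \<le> 4 * sqrt 2 / \<epsilon>"
  proof -
    have "\<epsilon> \<le> 8 * sqrt 2" using \<epsilon> s2 by linarith
    then show ?thesis using \<epsilon> by (simp add: field_simps)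
  qed
  \<comment> \<open>16/\<epsilon>^2 is at most (8 sqrt 2/\<epsilon>)^2, so the longer range up to
    \<open>8 / \<epsilon>\<^sup>2\<close> costs at most a factor 2 in the logarithm.\<close>
  have "ln (8 / \<epsilon>\<^sup>2 / (1 / 2)) \<le> ln ((4 * sqrt 2 / \<epsilon> / (1 / 2))\<^sup>2)"
    using \<epsilon> e2 by (intro ln_mono) (auto simp: power_divide power_mult_distrib divide_right_mono)
  also have "\<dots> = 2 * ln (4 * sqrt 2 / \<epsilon> / (1 / 2))" using \<epsilon> by (subst ln_realpow) auto
  finally have "ln (8 / \<epsilon>\<^sup>2 / (1 / 2)) \<le> 2 * ln (4 * sqrt 2 / \<epsilon> / (1 / 2))" .
  moreover have "0 \<le> ln (4 * sqrt 2 / \<epsilon> / (1 / 2))" using b2 by (intro ln_ge_zero) simp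
  ultimately have lnle: "4 * ln (8 / \<epsilon>\<^sup>2 / (1 / 2)) \<le> 64 * ln (4 * sqrt 2 / \<epsilon> / (1 / 2))"
    by linarith
  \<comment> \<open>Points \<open>v \<le> 1 / 2\<close> of the range are counted by the first
    indicator and all others by the second, also when \<open>4 / M\<close> exceeds 1/2. Double
    counting at 1/2 only increases the right side.\<close>
  have "(\<integral>\<^sup>+v\<in>{4 / M..8 / \<epsilon>\<^sup>2}. 1 / (ennreal v * (\<Phi> (min (1 / 2) v))\<^sup>2) \<partial>lborel)
    \<le> (\<integral>\<^sup>+v. 1 / (ennreal v * (\<Phi> v)\<^sup>2) * indicator {4 / M..1 / 2} v
          + 1 / (ennreal v * (\<Phi> (1 / 2))\<^sup>2) * indicator {1 / 2..8 / \<epsilon>\<^sup>2} v \<partial>lborel)"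
    by (intro nn_integral_mono) (auto simp: indicator_def min_def)
  also have "\<dots> = (\<integral>\<^sup>+v\<in>{4 / M..1 / 2}. 1 / (ennreal v * (\<Phi> v)\<^sup>2) \<partial>lborel) + ennreal (ln (8 / \<epsilon>\<^sup>2 / (1 / 2))) * K"
    unfolding int[OF b1, symmetric] by (rule nn_integral_add) measurable
  finally have "ennreal (4 / \<zeta>) * (\<integral>\<^sup>+v\<in>{4 / M..8 / \<epsilon>\<^sup>2}. 1 / (ennreal v * (\<Phi> (min (1 / 2) v))\<^sup>2) \<partial>lborel)
    \<le> ennreal (4 / \<zeta>) * ((\<integral>\<^sup>+v\<in>{4 / M..1 / 2}. 1 / (ennreal v * (\<Phi> v)\<^sup>2) \<partial>lborel) + ennreal (ln (8 / \<epsilon>\<^sup>2 / (1 / 2))) * K)"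
    by (rule mult_left_mono) simp
  also have "\<dots> = ennreal (4 / \<zeta>) * (\<integral>\<^sup>+v\<in>{4 / M..1 / 2}. 1 / (ennreal v * (\<Phi> v)\<^sup>2) \<partial>lborel)
      + ennreal (4 / \<zeta>) * ennreal (ln (8 / \<epsilon>\<^sup>2 / (1 / 2))) * K"
    by (simp add: distrib_left mult.assoc)
  also have "\<dots> \<le> ennreal (16 / \<zeta>) * (\<integral>\<^sup>+v\<in>{4 / M..1 / 2}. 1 / (ennreal v * (\<Phi> v)\<^sup>2) \<partial>lborel)
      + ennreal (64 / \<zeta>) * ennreal (ln (4 * sqrt 2 / \<epsilon> / (1 / 2))) * K"
  proof (intro add_mono mult_right_mono)
    show "ennreal (4 / \<zeta>) \<le> ennreal (16 / \<zeta>)" using \<zeta> by (intro ennreal_leI divide_right_mono) auto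
    have "4 / \<zeta> * ln (8 / \<epsilon>\<^sup>2 / (1 / 2)) \<le> 64 / \<zeta> * ln (4 * sqrt 2 / \<epsilon> / (1 / 2))"
      using divide_right_mono[OF lnle, of \<zeta>] \<zeta> by simp
    then show "ennreal (4 / \<zeta>) * ennreal (ln (8 / \<epsilon>\<^sup>2 / (1 / 2))) \<le> ennreal (64 / \<zeta>) * ennreal (ln (4 * sqrt 2 / \<epsilon> / (1 / 2)))"
      using \<zeta> by (simp add: ennreal_mult'[symmetric] ennreal_leI)
  qed simp_all
  finally show ?thesis by (simp only: int[OF b2] mult.assoc)
qed

section \<open>Assembling the mixing time bound\<close>

context reversible_chain
begin

text \<open>Until the chain has mixed, \<open>V k\<close> exceeds \<open>\<epsilon>\<^sup>2\<close>,
  so the recursion count with \<open>e = \<epsilon>\<^sup>2\<close> bounds the number of unmixed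
  steps.\<close>

lemma mixing_time_le:
  assumes \<nu>: "\<nu> \<in> warm_starts M \<mu>" and \<zeta>: "0 < \<zeta>" "\<And>x. \<zeta> \<le> measure (T x) {x}"
    and \<epsilon>: "0 < \<epsilon>" "\<epsilon> < 1" and s: "s = \<epsilon>\<^sup>2 / (16 * M\<^sup>2)"
    and pos: "0 < conductance_profile \<mu> T s (1 / 2)"
  shows "ennreal_of_enat (mixing_time \<mu> T \<epsilon> \<nu>) \<le> ennreal (4 / \<zeta>) *
    (\<integral>\<^sup>+v\<in>{4 / M..8 / \<epsilon>\<^sup>2}. 1 / (ennreal v * (conductance_profile \<mu> T s (min (1 / 2) v))\<^sup>2) \<partial>lborel)"
    (is "_ \<le> ?R")
proof -
  obtain h where hm: "h \<in> borel_measurable borel" and h: "\<And>x. 0 \<le> h x" "\<And>x. h x \<le> M"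
    and h1: "(\<integral>x. h x \<partial>\<mu>) = 1" and nu: "\<nu> = density \<mu> (\<lambda>x. ennreal (h x))"
    using warm_density[OF \<nu>] by metis
  define g where "g k = (step ^^ k) h" for k
  note law = law_after_density[OF hm h h1, folded g_def nu]
  have g: "g k \<in> borel_measurable borel" "0 \<le> g k x" "g k x \<le> M" "(\<integral>x. g k x \<partial>\<mu>) = 1" for k x
    using law[of k] by auto
  note [measurable] = g(1)
  define V where "V k = (\<integral>x. (g k x)\<^sup>2 \<partial>\<mu>) - 1" for k
  have ig: "integrable \<mu> (g k)" for k by (rule bounded_integrable_mu[where B = M]) (use g in auto)
  have g2: "\<bar>(g k x)\<^sup>2\<bar> \<le> M\<^sup>2" for k x using g(2,3)[of k x] by (intro abs_power2_le) simp
  have ig2: "integrable \<mu> (\<lambda>x. (g k x)\<^sup>2)" for k by (rule bounded_integrable_mu[OF _ g2]) simp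
  have V0: "0 \<le> V k" for k
  proof -
    have "0 \<le> (\<integral>x. (g k x - 1)\<^sup>2 \<partial>\<mu>)" by simp
    also have "\<dots> = V k" using ig ig2 g(4) by (simp add: V_def power2_diff mu.prob_space[simplified])
    finally show ?thesis .
  qed
  have M1: "1 \<le> M" by (rule warm_start_bound_ge_1[OF \<nu>])
  have VM: "V 0 \<le> M"
  proof -
    have "(\<integral>x. (g 0 x)\<^sup>2 \<partial>\<mu>) \<le> (\<integral>x. M * g 0 x \<partial>\<mu>)"
      using ig ig2 g(2,3) by (intro integral_mono) (auto simp: power2_eq_square mult_right_mono)
    then show ?thesis using g(4)[of 0] by (simp add: V_def)
  qed
  have chi: "chi2_divergence (law_after T k \<nu>) \<mu> = ennreal (V k)" for k
    using law[of k] chi2_density[OF g(1-4)[of k]] by (simp add: V_def)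
  \<comment> \<open>This fixes the value of \<open>s\<close>: before mixing,
    \<open>16 * (s * M\<^sup>2)\<close> is below \<open>V k\<close>, and
    \<open>2 * (s * M\<^sup>2)\<close> is \<epsilon>^2/8, at most 1.\<close>
  have sM: "16 * (s * M\<^sup>2) = \<epsilon>\<^sup>2" using M1 by (simp add: s)
  have s0: "0 \<le> s" by (simp add: s)
  have e1: "\<epsilon>\<^sup>2 \<le> 1" using \<epsilon> by (simp add: power_le_one)
  have count: "of_nat j \<le> ?R" if j: "\<And>k. k < j \<Longrightarrow> \<epsilon>\<^sup>2 < V k" for j
  proof (rule profile_recursion_count[where V = V, OF conductance_profile_antimono pos _ V0 VM \<zeta>(1) _ j])
    fix k p assume eV: "\<epsilon>\<^sup>2 < V k" and p: "0 \<le> p" "ennreal p \<le> conductance_profile \<mu> T s (min (1 / 2) (4 / V k))"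
    have "0 < V k" using eV zero_le_power2[of \<epsilon>] by linarith
    then have "p\<^sup>2 * V k / 4 \<le> dirichlet (g k)"
      using eV sM e1 p s0 unfolding V_def
      by (intro dirichlet_ge_conductance[where h = "g k" and B = M and s = s]) (use g in auto)
    then have "2 * \<zeta> * (p\<^sup>2 * V k / 4) \<le> 2 * \<zeta> * dirichlet (g k)" using \<zeta> by (intro mult_left_mono) auto
    moreover have "V (Suc k) \<le> V k - 2 * \<zeta> * dirichlet (g k)"
      using lazy_decay[of "g k" M \<zeta>] g(1-3)[of k] \<zeta> by (simp add: V_def g_def)
    ultimately show "V (Suc k) \<le> V k - \<zeta> / 2 * p\<^sup>2 * V k" by (simp add: algebra_simps)
  qed (use \<epsilon> in auto)
  define A where "A = {k. chi2_divergence (law_after T k \<nu>) \<mu> < \<infinity> \<and> sqrt (enn2real (chi2_divergence (law_after T k \<nu>) \<mu>)) \<le> \<epsilon>}"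
  have A: "k \<in> A \<longleftrightarrow> V k \<le> \<epsilon>\<^sup>2" for k
    using V0[of k] \<epsilon> by (auto simp: A_def chi real_sqrt_le_iff' intro: real_le_lsqrt sqrt_le_D)
  have mt: "mixing_time \<mu> T \<epsilon> \<nu> = Inf (enat ` A)" by (simp add: mixing_time_def A_def)
  show ?thesis
  proof (cases "A = {}")
    case True
    \<comment> \<open>If the chain never mixes, the right side dominates every natural number and is
      infinite, as is the infimum of the empty set.\<close>
    then have "of_nat j \<le> ?R" for j using A by (intro count) (metis empty_iff not_le)
    then have "\<not> ?R < top" using ennreal_Ex_less_of_nat[of ?R] leD by blast
    then have "?R = top" by (simp only: top.not_eq_extremum[symmetric] not_not)
    then show ?thesis by simp
  next
    case False
    define j where "j = (LEAST k. k \<in> A)"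
    have "j \<in> A" unfolding j_def using False by (auto intro: LeastI)
    then have "Inf (enat ` A) \<le> enat j" by (intro Inf_lower) auto
    then have "ennreal_of_enat (mixing_time \<mu> T \<epsilon> \<nu>) \<le> ennreal_of_enat (enat j)" unfolding mt by (simp only: ennreal_of_enat_le_iff)
    also have "\<dots> \<le> ?R" unfolding ennreal_of_enat_enat
    proof (rule count)
      fix k assume "k < j"
      then have "k \<notin> A" unfolding j_def by (rule not_less_Least)
      then show "\<epsilon>\<^sup>2 < V k" using A not_le by blast
    qed
    finally show ?thesis .
  qed
qed

end

theorem lemma3:
  fixes \<mu> :: "'a::euclidean_space measure"
    and T :: "'a \<Rightarrow> 'a measure"
    and \<zeta> \<epsilon> M\<^sub>0 s :: real
  assumes "markov_kernel T"
    and "stationary \<mu> T"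
    and "reversible \<mu> T"
    and "irreducible_chain T"
    and "lazy_chain \<zeta> T" and "0 < \<zeta>"
    and "smooth_chain T"
    and "0 < \<epsilon>" and "\<epsilon> < 1"
    and "s = \<epsilon>\<^sup>2 / (16 * M\<^sub>0\<^sup>2)"
  shows "ennreal_of_enat (max_mixing_time \<mu> T \<epsilon> M\<^sub>0) \<le>
      ennreal (16 / \<zeta>) *
        (\<integral>\<^sup>+v\<in>{4 / M\<^sub>0..1 / 2}. 1 / (ennreal v * (conductance_profile \<mu> T s v)\<^sup>2) \<partial>lborel) +
      ennreal (64 / \<zeta>) *
        (\<integral>\<^sup>+v\<in>{1 / 2..4 * sqrt 2 / \<epsilon>}. 1 / (ennreal v * (conductance_profile \<mu> T s (1 / 2))\<^sup>2) \<partial>lborel)"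
    (is "_ \<le> ?R1 + ennreal (64 / \<zeta>) * ?I2")
proof (cases "conductance_profile \<mu> T s (1 / 2) = 0")
  case True
  \<comment> \<open>A vanishing profile makes the second integrand infinite on an interval of
    positive length, so the right side is infinite.\<close>
  have "1 \<le> sqrt (2::real)" by simp
  then have "\<epsilon> < 8 * sqrt 2" using assms(9) by linarith
  then have "1 / 2 < 4 * sqrt 2 / \<epsilon>" using assms(8) by (simp add: field_simps)
  then have "emeasure lborel {1 / 2..4 * sqrt 2 / \<epsilon>} = ennreal (4 * sqrt 2 / \<epsilon> - 1 / 2)"
    and "0 < 4 * sqrt 2 / \<epsilon> - 1 / 2"
    by (intro emeasure_lborel_Icc, linarith, linarith)
  then have "emeasure lborel {1 / 2..4 * sqrt 2 / \<epsilon>} \<noteq> 0" by (metis ennreal_eq_0_iff not_le)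
  moreover have "?I2 = (\<integral>\<^sup>+v. top * indicator {1 / 2..4 * sqrt 2 / \<epsilon>} v \<partial>lborel)"
    using True by (simp add: power2_eq_square)
  moreover have "\<dots> = top * emeasure lborel {1 / 2..4 * sqrt 2 / \<epsilon>}"
    by (rule nn_integral_cmult_indicator) simp
  ultimately have "?I2 = top" by (simp only: ennreal_top_mult if_False)
  then show ?thesis using assms(6) by (simp add: ennreal_mult_top)
next
  case False
  interpret reversible_chain \<mu> T using assms by unfold_locales
  \<comment> \<open>Evaluating laziness on the singleton keeps the held mass \<open>\<zeta>\<close>
    at \<open>x\<close>.\<close>
  have \<zeta>: "\<zeta> \<le> measure (T x) {x}" for x
  proof -
    have "ennreal \<zeta> \<le> emeasure (T x) {x}" using assms(5) unfolding lazy_chain_def by force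
    then show ?thesis by (simp add: T.emeasure_eq_measure)
  qed
  have "ennreal_of_enat (mixing_time \<mu> T \<epsilon> \<nu>) \<le> ?R1 + ennreal (64 / \<zeta>) * ?I2" if \<nu>: "\<nu> \<in> warm_starts M\<^sub>0 \<mu>" for \<nu>
  proof -
    have "0 < conductance_profile \<mu> T s (1 / 2)" using False by (simp add: less_le)
    note mixing_time_le[OF \<nu> assms(6) \<zeta> assms(8-10) this]
    also note profile_integral_le[OF conductance_profile_antimono assms(8,9,6)]
    finally show ?thesis .
  qed
  then show ?thesis
    unfolding max_mixing_time_def ennreal_of_enat_Sup by (auto intro!: SUP_least)
qed

end
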